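(* Let $d$ and $k$ be integers with $1\le k\le d-1$. There is a constant $C=C(d,k)$ such that the following holds. Let $\Lambda\subseteq\mathbb{R}^d$ be a $d$-dimensional lattice, write $\lambda_i=\lambda_i(\Lambda,B^d)$ for $i=1,\dots,d$, and assume $\lambda_d\le 1$. Then $\Lambda\cap B^d$ can be covered by at most $C\,\alpha^{d-k}$ $k$-dimensional linear subspaces of $\mathbb{R}^d$, where \[\alpha=\min_{d-k+1\le i\le d}(\lambda_{d-i+1}\cdots\lambda_d)^{-1/(i-1)}.\]
   Context: $B^d$ is the closed unit Euclidean ball in $\mathbb{R}^d$ centered at the origin. A $d$-dimensional lattice is the set of all integer linear combinations of $d$ linearly independent vectors of $\mathbb{R}^d$. For a lattice $\Lambda$ and a compact convex body $K$ symmetric about the origin, the $i$th successive minimum is $\lambda_i(\Lambda,K)=\inf\{\lambda\in\mathbb{R}:\dim(\Lambda\cap(\lambda K))\ge i\}$, where $\dim$ denotes the dimension of the affine hull. *)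

theory Defs
  imports "HOL-Analysis.Analysis"
begin

definition is_lattice :: "'a::euclidean_space set \<Rightarrow> bool" where
  "is_lattice L \<longleftrightarrow> (\<exists>B. independent B \<and> card B = DIM('a) \<and>
     L = {(\<Sum>b\<in>B. of_int (c b) *\<^sub>R b) | c. True})"

definition succ_min :: "'a::euclidean_space set \<Rightarrow> 'a set \<Rightarrow> nat \<Rightarrow> real" where
  "succ_min L K i = Inf {lam::real. lam > 0 \<and> aff_dim (L \<inter> ((\<lambda>x. lam *\<^sub>R x) ` K)) \<ge> int i}"

definition alpha :: "'a::euclidean_space set \<Rightarrow> nat \<Rightarrow> real" where
  "alpha L k = Min ((\<lambda>i. (\<Prod>j\<in>{DIM('a) - i + 1..DIM('a)}. succ_min L (cball 0 1) j)
                         powr (- 1 / (real i - 1)))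
                    ` {DIM('a) - k + 1..DIM('a)})"

end

theory Submission
  imports Defs
begin

text \<open>
  By a weak form of lattice reduction, the lattice has a basis in which its points in the unit ball
  have integer coordinates bounded by \<open>n\<^sub>j = O(1 / \<lambda>\<^sub>j)\<close>, so the problem becomes one about integer points
  of boxes.  For every admissible \<open>i\<close>, projecting away the \<open>d - i\<close> coordinates with the smallest
  \<open>\<lambda>\<^sub>j\<close> reduces the claim to the following: a box with \<open>m\<close> sides \<open>n\<^sub>j \<ge> 1\<close> is covered by
  \<open>O(P powr ((m - k) / (m - 1)))\<close> subspaces of dimension \<open>k\<close>, where \<open>P\<close> is the product of the sides.

  This is proved by induction on \<open>m\<close>.  Put \<open>\<alpha> = P powr (1 / (m - 1))\<close>.  If some side exceeds \<open>\<alpha>\<close>,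
  project that coordinate away.  Otherwise, by the pigeonhole principle every point of the box is
  orthogonal to a nonzero dual lattice vector \<open>w\<close> of size \<open>O(\<alpha>)\<close>.  There are \<open>O(r)\<close> such vectors of
  size at most \<open>r\<close>, and the hyperplane orthogonal to a primitive \<open>w\<close> meets the box in a set
  that is contained in a box of dimension \<open>m - 1\<close> with product of sides \<open>O(P / |w|)\<close>.  Applying the
  induction hypothesis inside each hyperplane and summing over \<open>w\<close> gives the bound.
\<close>

text \<open>Rescaling each axis by its side turns a box into the cube [-1,1]^m in the grid with
  spacings 1/n_j; the dual grid has spacings n_j and covolume P, and sizes of dual vectors are sup
  norms. The linear count of dual vectors relies on every n_j being O(\<alpha>), while a side longer
  than \<alpha> can be given up at a gain that pays for the lost dimension: this dictates the two
  cases. With \<beta> = (m-1-k)/(m-2) the hyperplane of w costs (P/|w|)^\<beta>, and summing over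
  |w| = O(\<alpha>) yields \<alpha>^((m-1)\<beta> + 1 - \<beta>) = \<alpha>^(m-k). This needs
  \<beta> < 1, that is k >= 2; at k = 1 the sum would bring in a logarithm, but there the bound is P
  itself and counting points suffices. A further obstacle is that the induction hypothesis wants
  sides at least 1. The reduced basis of a hyperplane section can violate this only if the section
  fails to span the hyperplane; then two coordinates of the original box are dropped instead, which
  is why the induction also calls on dimension m-2.\<close>

subsection \<open>Reduced bases\<close>

text \<open>A lattice of arbitrary rank given without a basis: projections and hyperplane sections
  arise in this form, and \<open>reduced_basis\<close> then equips them with one.\<close>

definition discrete_subgroup :: "'a::euclidean_space set \<Rightarrow> bool" where
  "discrete_subgroup L \<longleftrightarrow>
     0 \<in> L \<and> (\<forall>x\<in>L. \<forall>y\<in>L. x - y \<in> L) \<and> (\<forall>r. finite (L \<inter> cball 0 r))"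

lemma discrete_subgroup_add:
  assumes "discrete_subgroup L" "x \<in> L" "y \<in> L"
  shows "x + y \<in> L"
proof -
  have "x - (0 - y) \<in> L"
    using assms unfolding discrete_subgroup_def by blast
  then show ?thesis by simp
qed

lemma discrete_subgroup_scale_nat:
  assumes "discrete_subgroup L" "x \<in> L"
  shows "of_nat k *\<^sub>R x \<in> L"
proof (induction k)
  case 0
  then show ?case using assms by (simp add: discrete_subgroup_def)
next
  case (Suc k)
  then have "x + of_nat k *\<^sub>R x \<in> L"
    using assms discrete_subgroup_add by blast
  then show ?case by (simp add: algebra_simps)
qed

lemma discrete_subgroup_scale:
  assumes L: "discrete_subgroup L" "x \<in> L"
  shows "of_int k *\<^sub>R x \<in> L"
proof (cases "k \<ge> 0")
  case True
  then show ?thesis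
    using discrete_subgroup_scale_nat[OF L, of "nat k"] by simp
next
  case False
  then have "of_int k *\<^sub>R x = 0 - of_nat (nat (- k)) *\<^sub>R x"
    by simp
  then show ?thesis
    using discrete_subgroup_scale_nat[OF L, of "nat (-k)"] L
    unfolding discrete_subgroup_def by (metis)
qed

lemma discrete_subgroup_sum:
  assumes "discrete_subgroup L" "\<And>i. i \<in> I \<Longrightarrow> f i \<in> L"
  shows "(\<Sum>i\<in>I. of_int (c i) *\<^sub>R f i) \<in> L"
  using assms(2)
proof (induction I rule: infinite_finite_induct)
  case (insert i I)
  then show ?case
    using assms(1) by (simp add: discrete_subgroup_add discrete_subgroup_scale)
qed (use assms(1) in \<open>auto simp: discrete_subgroup_def\<close>)

text \<open>Only finitely many points are no longer than \<open>v\<close>, so a minimum is attained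
  among them.\<close>

lemma discrete_subgroup_shortest:
  assumes L: "discrete_subgroup L" and v: "v \<in> L" "v \<noteq> 0"
  obtains b where "b \<in> L" "b \<noteq> 0" "\<And>x. x \<in> L \<Longrightarrow> x \<noteq> 0 \<Longrightarrow> norm b \<le> norm x"
proof -
  define A where "A = L \<inter> cball 0 (norm v) - {0}"
  have A: "finite A" "v \<in> A"
    using L v by (auto simp: A_def discrete_subgroup_def)
  define b where "b = arg_min_on norm A"
  have b: "b \<in> A" "\<And>x. x \<in> A \<Longrightarrow> norm b \<le> norm x"
    unfolding b_def using A by (auto intro!: arg_min_if_finite arg_min_least)
  show ?thesis
  proof (rule that[of b])
    fix x assume x: "x \<in> L" "x \<noteq> 0"
    show "norm b \<le> norm x"
    proof (cases "norm x \<le> norm v")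
      case True
      then show ?thesis using x b(2) by (auto simp: A_def)
    next
      case False
      then show ?thesis using b(2)[OF A(2)] by simp
    qed
  qed (use b in \<open>auto simp: A_def\<close>)
qed

text \<open>A weak form of Korkine--Zolotarev reduction: project along a shortest vector and lift a
  reduced basis of the projected lattice as close to the orthogonal complement as possible.\<close>

lemma reduced_basis:
  "\<exists>C\<ge>1. \<forall>L::'a::euclidean_space set. discrete_subgroup L \<and> dim L = m \<longrightarrow>
     (\<exists>B\<subseteq>L. finite B \<and> card B = m \<and> independent B \<and>
        (\<forall>x\<in>L. \<exists>c::'a \<Rightarrow> int. x = (\<Sum>b\<in>B. of_int (c b) *\<^sub>R b) \<and>
           (\<forall>b\<in>B. \<bar>of_int (c b)\<bar> * norm b \<le> C * norm x)))"
proof (induction m)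
  case 0
  show ?case
  proof (intro exI[of _ 1] conjI allI impI)
    fix L :: "'a set" assume "discrete_subgroup L \<and> dim L = 0"
    then have "L \<subseteq> {0}" by (auto simp: dim_eq_0)
    then show "\<exists>B\<subseteq>L. finite B \<and> card B = 0 \<and> independent B \<and>
        (\<forall>x\<in>L. \<exists>c::'a \<Rightarrow> int. x = (\<Sum>b\<in>B. of_int (c b) *\<^sub>R b) \<and>
           (\<forall>b\<in>B. \<bar>of_int (c b)\<bar> * norm b \<le> 1 * norm x))"
      by (intro exI[of _ "{}"]) (auto simp: independent_empty)
  qed auto
next
  case (Suc m)
  then obtain C where C: "C \<ge> 1"
    and IH: "\<And>L::'a set. discrete_subgroup L \<Longrightarrow> dim L = m \<Longrightarrow>
     (\<exists>B\<subseteq>L. finite B \<and> card B = m \<and> independent B \<and>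
        (\<forall>x\<in>L. \<exists>c::'a \<Rightarrow> int. x = (\<Sum>b\<in>B. of_int (c b) *\<^sub>R b) \<and>
           (\<forall>b\<in>B. \<bar>of_int (c b)\<bar> * norm b \<le> C * norm x)))"
    by blast
  \<comment> \<open>\<open>1 + 2 * C * m\<close> will bound the coefficient of the new vector
    \<open>b1\<close> by the triangle inequality, \<open>2 * C\<close> those of the lifted
    vectors.\<close>
  define C' where "C' = 1 + 2 * C * m + 2 * C"
  show ?case
  proof (intro exI[of _ C'] conjI allI impI)
    show "C' \<ge> 1" using C by (simp add: C'_def)
  next
    fix L :: "'a set" assume "discrete_subgroup L \<and> dim L = Suc m"
    then have L: "discrete_subgroup L" and dimL: "dim L = Suc m" by auto
    have "\<not> L \<subseteq> {0}"
      using dimL by (metis dim_eq_0 nat.simps(3))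
    then obtain v where "v \<in> L" "v \<noteq> 0" by auto
    then obtain b1 where b1: "b1 \<in> L" "b1 \<noteq> 0"
      and short: "\<And>x. x \<in> L \<Longrightarrow> x \<noteq> 0 \<Longrightarrow> norm b1 \<le> norm x"
      using discrete_subgroup_shortest[OF L] by metis
    define \<pi> where "\<pi> x = x - ((x \<bullet> b1) / (b1 \<bullet> b1)) *\<^sub>R b1" for x
    have lin: "linear \<pi>"
      unfolding \<pi>_def by (intro linearI) (auto simp: algebra_simps add_divide_distrib)
    have \<pi>b1: "\<pi> b1 = 0" using b1 by (simp add: \<pi>_def)
    have orth: "\<pi> x \<bullet> b1 = 0" for x
      using b1 by (simp add: \<pi>_def inner_diff_left)
    have norm_\<pi>: "norm (\<pi> x) \<le> norm x" for x
    proof -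
      have "x = \<pi> x + ((x \<bullet> b1) / (b1 \<bullet> b1)) *\<^sub>R b1" by (simp add: \<pi>_def)
      moreover have "orthogonal (\<pi> x) (((x \<bullet> b1) / (b1 \<bullet> b1)) *\<^sub>R b1)"
        using orth by (simp add: orthogonal_def)
      ultimately have "(norm x)\<^sup>2 = (norm (\<pi> x))\<^sup>2 + (norm (((x \<bullet> b1) / (b1 \<bullet> b1)) *\<^sub>R b1))\<^sup>2"
        by (metis norm_add_Pythagorean)
      then have "(norm (\<pi> x))\<^sup>2 \<le> (norm x)\<^sup>2" by simp
      then show ?thesis by (simp add: power2_le_iff_abs_le)
    qed
    \<comment> \<open>Subtracting a suitable integer multiple of \<open>b1\<close> makes the
      component along \<open>b1\<close> at most half of \<open>norm b1\<close> without changing the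
      projection.\<close>
    have lift: "\<exists>y\<in>L. \<pi> y = \<pi> x \<and> norm y \<le> norm (\<pi> x) + norm b1 / 2" if x: "x \<in> L" for x
    proof -
      define t where "t = (x \<bullet> b1) / (b1 \<bullet> b1)"
      define y where "y = x - of_int (round t) *\<^sub>R b1"
      have "y \<in> L"
        using L x discrete_subgroup_scale[OF L b1(1)]
        unfolding y_def discrete_subgroup_def by blast
      moreover have py: "\<pi> y = \<pi> x"
        unfolding y_def using lin \<pi>b1 by (simp add: linear_diff linear_scale)
      moreover have "norm y \<le> norm (\<pi> x) + norm b1 / 2"
      proof -
        have "y = \<pi> x + (t - of_int (round t)) *\<^sub>R b1"
          unfolding y_def \<pi>_def t_def by (simp add: algebra_simps)
        then have "norm y \<le> norm (\<pi> x) + \<bar>t - of_int (round t)\<bar> * norm b1"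
          by (metis norm_triangle_ineq norm_scaleR)
        also have "\<bar>t - of_int (round t)\<bar> * norm b1 \<le> (1/2) * norm b1"
          using of_int_round_abs_le[of t] by (intro mult_right_mono) (auto simp: abs_minus_commute)
        finally show ?thesis by simp
      qed
      ultimately show ?thesis by blast
    qed
    define L' where "L' = \<pi> ` L"
    have L': "discrete_subgroup L'"
      unfolding discrete_subgroup_def
    proof (intro conjI ballI allI)
      show "0 \<in> L'" unfolding L'_def using b1 \<pi>b1 by force
      show "x - y \<in> L'" if "x \<in> L'" "y \<in> L'" for x y
      proof -
        obtain x' y' where "x = \<pi> x'" "y = \<pi> y'" "x' \<in> L" "y' \<in> L"
          using \<open>x \<in> L'\<close> \<open>y \<in> L'\<close> by (auto simp: L'_def)
        then have "x - y = \<pi> (x' - y')" "x' - y' \<in> L"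
          using lin L by (auto simp: linear_diff discrete_subgroup_def)
        then show ?thesis by (auto simp: L'_def)
      qed
      \<comment> \<open>A projection of a discrete group need not be discrete; here every projected
        point has a lift of controlled length.\<close>
      show "finite (L' \<inter> cball 0 r)" for r
      proof (rule finite_subset)
        show "L' \<inter> cball 0 r \<subseteq> \<pi> ` (L \<inter> cball 0 (r + norm b1 / 2))"
        proof
          fix z assume "z \<in> L' \<inter> cball 0 r"
          then obtain x where x: "x \<in> L" "z = \<pi> x" "norm z \<le> r" by (auto simp: L'_def)
          obtain y where "y \<in> L" "\<pi> y = \<pi> x" "norm y \<le> norm (\<pi> x) + norm b1 / 2"
            using lift[OF x(1)] by blast
          then show "z \<in> \<pi> ` (L \<inter> cball 0 (r + norm b1 / 2))"
            using x by (intro image_eqI[of _ _ y]) auto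
        qed
        show "finite (\<pi> ` (L \<inter> cball 0 (r + norm b1 / 2)))"
          using L by (auto simp: discrete_subgroup_def)
      qed
    qed
    have dimL': "dim L' = m"
    proof -
      have "span L' \<subseteq> {x. x \<bullet> b1 = 0}"
        by (rule span_minimal) (auto simp: L'_def orth subspace_hyperplane2)
      then have notin: "b1 \<notin> span L'" using b1 by auto
      have "L \<subseteq> span (insert b1 L')"
      proof
        fix x assume "x \<in> L"
        then have "\<pi> x \<in> span (insert b1 L')" "b1 \<in> span (insert b1 L')"
          by (auto simp: L'_def intro: span_base)
        then have "\<pi> x + ((x \<bullet> b1) / (b1 \<bullet> b1)) *\<^sub>R b1 \<in> span (insert b1 L')"
          by (intro span_add span_scale)
        then show "x \<in> span (insert b1 L')" by (simp add: \<pi>_def)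
      qed
      moreover have "insert b1 L' \<subseteq> span L"
        unfolding L'_def \<pi>_def using b1 by (auto intro: span_diff span_scale span_base)
      ultimately have "span L = span (insert b1 L')"
        by (meson span_minimal subspace_span subset_antisym)
      then have "dim L = dim (insert b1 L')" by (metis dim_span)
      then show ?thesis using notin dimL by (simp add: dim_insert)
    qed
    obtain B where B: "B \<subseteq> L'" "finite B" "card B = m" "independent B"
      and Bc: "\<And>x. x \<in> L' \<Longrightarrow> \<exists>c::'a \<Rightarrow> int. x = (\<Sum>b\<in>B. of_int (c b) *\<^sub>R b) \<and>
           (\<forall>b\<in>B. \<bar>of_int (c b)\<bar> * norm b \<le> C * norm x)"
      using IH[OF L' dimL'] by blast
    have "\<forall>b\<in>B. \<exists>y\<in>L. \<pi> y = b \<and> norm y \<le> norm b + norm b1 / 2"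
      using B(1) lift by (force simp: L'_def)
    then obtain g where g: "\<And>b. b \<in> B \<Longrightarrow> g b \<in> L" "\<And>b. b \<in> B \<Longrightarrow> \<pi> (g b) = b"
      "\<And>b. b \<in> B \<Longrightarrow> norm (g b) \<le> norm b + norm b1 / 2"
      by metis
    have B0: "0 \<notin> B" using B(4) dependent_zero by blast
    \<comment> \<open>A lift \<open>g b\<close> is a nonzero point of \<open>L\<close>, so
      \<open>norm b1 \<le> norm (g b) \<le> norm b + norm b1 / 2\<close>. Hence the rounding error
      \<open>norm b1 / 2\<close> is at most \<open>norm b\<close>.\<close>
    have g2: "norm (g b) \<le> 2 * norm b" if "b \<in> B" for b
    proof -
      have "g b \<noteq> 0" using g(2)[OF that] B0 that lin by (metis linear_0)
      then have "norm b1 \<le> norm (g b)" using short g(1) that by blast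
      then show ?thesis using g(3)[OF that] by simp
    qed
    have inj: "inj_on g B" by (rule inj_on_inverseI[of _ \<pi>]) (use g in auto)
    have b1g: "b1 \<notin> g ` B" using B0 g(2) \<pi>b1 by auto
    define B' where "B' = insert b1 (g ` B)"
    have fin: "finite B'" and card: "card B' = Suc m"
      using B inj b1g by (auto simp: B'_def card_image)
    have sub: "B' \<subseteq> L" using g b1 by (auto simp: B'_def)
    have coeff: "\<exists>c::'a \<Rightarrow> int. x = (\<Sum>b\<in>B'. of_int (c b) *\<^sub>R b) \<and>
           (\<forall>b\<in>B'. \<bar>of_int (c b)\<bar> * norm b \<le> C' * norm x)" if x: "x \<in> L" for x
    proof -
      have "\<pi> x \<in> L'" using x by (auto simp: L'_def)
      then obtain c :: "'a \<Rightarrow> int" where c: "\<pi> x = (\<Sum>b\<in>B. of_int (c b) *\<^sub>R b)"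
         "\<And>b. b \<in> B \<Longrightarrow> \<bar>of_int (c b)\<bar> * norm b \<le> C * norm (\<pi> x)"
        using Bc by blast
      have cg: "\<bar>of_int (c b)\<bar> * norm (g b) \<le> 2 * C * norm x" if "b \<in> B" for b
      proof -
        have "\<bar>of_int (c b)\<bar> * norm (g b) \<le> \<bar>of_int (c b)\<bar> * (2 * norm b)"
          using g2[OF that] by (intro mult_left_mono) auto
        also have "\<dots> \<le> 2 * (C * norm (\<pi> x))" using c(2)[OF that] by simp
        also have "\<dots> \<le> 2 * (C * norm x)" using norm_\<pi> C by simp
        finally show ?thesis by simp
      qed
      define v where "v = x - (\<Sum>b\<in>B. of_int (c b) *\<^sub>R g b)"
      have vL: "v \<in> L"
        using L x discrete_subgroup_sum[OF L, of B g c] g(1)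
        unfolding v_def discrete_subgroup_def by blast
      have "\<pi> (\<Sum>b\<in>B. of_int (c b) *\<^sub>R g b) = (\<Sum>b\<in>B. of_int (c b) *\<^sub>R b)"
        using lin g(2) by (simp add: linear_sum linear_scale)
      then have "\<pi> v = 0"
        unfolding v_def using lin c(1) by (simp add: linear_diff)
      define t where "t = (v \<bullet> b1) / (b1 \<bullet> b1)"
      have vt: "v = t *\<^sub>R b1" using \<open>\<pi> v = 0\<close> by (simp add: \<pi>_def t_def)
      \<comment> \<open>\<open>v\<close> is a real multiple of \<open>b1\<close>; a non-integer
        multiple would leave a nonzero remainder of at most half the shortest length.\<close>
      have "v - of_int (round t) *\<^sub>R b1 = 0"
      proof (rule ccontr)
        assume nz: "v - of_int (round t) *\<^sub>R b1 \<noteq> 0"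
        have "v - of_int (round t) *\<^sub>R b1 \<in> L"
          using L vL discrete_subgroup_scale[OF L b1(1)] unfolding discrete_subgroup_def by blast
        then have "norm b1 \<le> norm (v - of_int (round t) *\<^sub>R b1)" using short nz by blast
        also have "v - of_int (round t) *\<^sub>R b1 = (t - of_int (round t)) *\<^sub>R b1"
          by (simp add: vt algebra_simps)
        also have "norm \<dots> = \<bar>t - of_int (round t)\<bar> * norm b1" by simp
        also have "\<bar>t - of_int (round t)\<bar> * norm b1 \<le> (1/2) * norm b1"
          using of_int_round_abs_le[of t] by (intro mult_right_mono) (auto simp: abs_minus_commute)
        finally show False using b1 by simp
      qed
      then have vr: "v = of_int (round t) *\<^sub>R b1" by simp
      \<comment> \<open>\<open>\<pi>\<close> undoes the lift \<open>g\<close>, so it finds the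
        coefficient that belongs to a lifted vector.\<close>
      define c' where "c' b = (if b = b1 then round t else c (\<pi> b))" for b
      have "(\<Sum>b\<in>B'. of_int (c' b) *\<^sub>R b) =
          of_int (round t) *\<^sub>R b1 + (\<Sum>b\<in>g ` B. of_int (c' b) *\<^sub>R b)"
        unfolding B'_def using B(2) b1g by (simp add: c'_def)
      also have "(\<Sum>b\<in>g ` B. of_int (c' b) *\<^sub>R b) = (\<Sum>b\<in>B. of_int (c' (g b)) *\<^sub>R g b)"
        using inj by (simp add: sum.reindex)
      also have "\<dots> = (\<Sum>b\<in>B. of_int (c b) *\<^sub>R g b)"
        using b1g g(2) by (intro sum.cong) (auto simp: c'_def)
      also have "of_int (round t) *\<^sub>R b1 + \<dots> = x" using vr[symmetric] by (simp add: v_def)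
      finally have xeq: "x = (\<Sum>b\<in>B'. of_int (c' b) *\<^sub>R b)" by simp
      have "norm v \<le> norm x + norm (\<Sum>b\<in>B. of_int (c b) *\<^sub>R g b)"
        unfolding v_def by (rule norm_triangle_ineq4)
      also have "norm (\<Sum>b\<in>B. of_int (c b) *\<^sub>R g b) \<le> (\<Sum>b\<in>B. 2 * C * norm x)"
        using cg by (intro sum_norm_le) auto
      also have "\<dots> = 2 * C * m * norm x" using B(3) by simp
      finally have "norm v \<le> (1 + 2 * C * m) * norm x" by (simp add: algebra_simps)
      then have v': "norm v \<le> C' * norm x"
        unfolding C'_def using C by (smt (verit) mult_right_mono norm_ge_zero)
      have "\<bar>of_int (c' b)\<bar> * norm b \<le> C' * norm x" if bB': "b \<in> B'" for b
      proof (cases "b = b1")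
        case True
        then show ?thesis using v' vr by (simp add: c'_def)
      next
        case False
        then obtain b0 where b0: "b0 \<in> B" "b = g b0" using bB' False unfolding B'_def by blast
        have "\<bar>of_int (c' b)\<bar> * norm b = \<bar>of_int (c b0)\<bar> * norm (g b0)"
          using False b0 g(2) by (simp add: c'_def)
        also have "\<dots> \<le> 2 * C * norm x" using cg b0 by blast
        also have "\<dots> \<le> C' * norm x"
          unfolding C'_def using C by (intro mult_right_mono) auto
        finally show ?thesis .
      qed
      then show ?thesis using xeq by blast
    qed
    have spn: "L \<subseteq> span B'"
    proof
      fix x assume "x \<in> L"
      then obtain c :: "'a \<Rightarrow> int" where c: "x = (\<Sum>b\<in>B'. of_int (c b) *\<^sub>R b)" using coeff by blast
      show "x \<in> span B'" unfolding c by (intro span_sum span_scale span_base)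
    qed
    have "independent B'"
      by (rule card_le_dim_spanning[OF sub spn fin]) (simp add: card dimL)
    then show "\<exists>B\<subseteq>L. finite B \<and> card B = Suc m \<and> independent B \<and>
        (\<forall>x\<in>L. \<exists>c::'a \<Rightarrow> int. x = (\<Sum>b\<in>B. of_int (c b) *\<^sub>R b) \<and>
           (\<forall>b\<in>B. \<bar>of_int (c b)\<bar> * norm b \<le> C' * norm x))"
      using fin card sub coeff by blast
  qed
qed

subsection \<open>Coverings and boxes\<close>

text \<open>Dimension at most \<open>k\<close>, instead of exactly \<open>k\<close>, keeps the
  notion stable under linear images; \<open>coverable_exact_dim\<close> restores equality at the
  end.\<close>

definition coverable :: "'a::euclidean_space set \<Rightarrow> nat \<Rightarrow> real \<Rightarrow> bool" where
  "coverable X k t \<longleftrightarrow>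
     (\<exists>S. finite S \<and> (\<forall>V\<in>S. subspace V \<and> dim V \<le> k) \<and> X \<subseteq> \<Union>S \<and> real (card S) \<le> t)"

lemma coverable_mono:
  assumes "coverable X k s" "Y \<subseteq> X" "k \<le> l" "s \<le> t"
  shows "coverable Y l t"
  using assms unfolding coverable_def by (meson order_trans)

lemma coverable_single:
  assumes "dim X \<le> k" "1 \<le> t"
  shows "coverable X k t"
  unfolding coverable_def using assms
  by (intro exI[of _ "{span X}"]) (auto simp: span_base)

lemma coverable_points:
  assumes "finite X" "real (card X) \<le> t" "1 \<le> k"
  shows "coverable X k t"
  unfolding coverable_def
proof (intro exI[of _ "(\<lambda>x. span {x}) ` X"] conjI ballI)
  show "real (card ((\<lambda>x. span {x}) ` X)) \<le> t"
    using card_image_le[OF assms(1), of "\<lambda>x. span {x}"] assms(2) by linarith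
  show "dim V \<le> k" if V: "V \<in> (\<lambda>x. span {x}) ` X" for V
  proof -
    from V obtain x where "V = span {x}" by auto
    then have "dim V \<le> card {x}" by (metis dim_span dim_le_card' finite.emptyI finite.insertI)
    then show ?thesis using assms(3) by simp
  qed
qed (use assms(1) in \<open>auto simp: span_base\<close>)

lemma coverable_UN:
  assumes Y: "finite Y" and cov: "\<And>y. y \<in> Y \<Longrightarrow> coverable (X y) k (t y)" and sub: "Z \<subseteq> (\<Union>y\<in>Y. X y)"
  shows "coverable Z k (\<Sum>y\<in>Y. t y)"
proof -
  obtain S where S: "\<And>y. y \<in> Y \<Longrightarrow> finite (S y)"
    "\<And>y V. y \<in> Y \<Longrightarrow> V \<in> S y \<Longrightarrow> subspace V \<and> dim V \<le> k"
    "\<And>y. y \<in> Y \<Longrightarrow> X y \<subseteq> \<Union>(S y)" "\<And>y. y \<in> Y \<Longrightarrow> real (card (S y)) \<le> t y"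
    using cov unfolding coverable_def by metis
  have "real (card (\<Union>y\<in>Y. S y)) \<le> (\<Sum>y\<in>Y. real (card (S y)))"
    using card_UN_le[OF Y, of S] by (metis of_nat_le_iff of_nat_sum)
  also have "\<dots> \<le> (\<Sum>y\<in>Y. t y)" using S(4) by (rule sum_mono)
  finally have "real (card (\<Union>y\<in>Y. S y)) \<le> (\<Sum>y\<in>Y. t y)" .
  moreover have "Z \<subseteq> \<Union>(\<Union>y\<in>Y. S y)" using sub S(3) by blast
  ultimately show ?thesis
    unfolding coverable_def using Y S(1,2) by (intro exI[of _ "\<Union>y\<in>Y. S y"]) auto
qed

lemma coverable_linear_image:
  assumes f: "linear f" and cov: "coverable X k t"
  shows "coverable (f ` X) k t"
proof -
  obtain S where S: "finite S" "\<And>V. V \<in> S \<Longrightarrow> subspace V \<and> dim V \<le> k" "X \<subseteq> \<Union>S" "real (card S) \<le> t"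
    using cov unfolding coverable_def by auto
  show ?thesis unfolding coverable_def
  proof (intro exI[of _ "(`) f ` S"] conjI ballI)
    show "real (card ((`) f ` S)) \<le> t"
      using card_image_le[OF S(1), of "(`) f"] S(4) by linarith
    show "dim V \<le> k" if "V \<in> (`) f ` S" for V
      using that S(2) dim_image_le[OF f] by (auto intro: order_trans)
    show "f ` X \<subseteq> \<Union> ((`) f ` S)" using S(3) by blast
  qed (use S f in \<open>auto intro: linear_subspace_image\<close>)
qed

text \<open>Undoes a projection: a covering of the image is pulled back by adding the kernel,
  spanned by \<open>W\<close>, to every subspace.\<close>

lemma coverable_plus_span:
  assumes cov: "coverable X k t" and Z: "\<And>z. z \<in> Z \<Longrightarrow> \<exists>x\<in>X. z - x \<in> span W" and W: "finite W"
  shows "coverable Z (k + card W) t"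
proof -
  obtain S where S: "finite S" "\<And>V. V \<in> S \<Longrightarrow> subspace V \<and> dim V \<le> k" "X \<subseteq> \<Union>S" "real (card S) \<le> t"
    using cov unfolding coverable_def by auto
  show ?thesis unfolding coverable_def
  proof (intro exI[of _ "(\<lambda>V. span (V \<union> W)) ` S"] conjI ballI)
    show "real (card ((\<lambda>V. span (V \<union> W)) ` S)) \<le> t"
      using card_image_le[OF S(1), of "\<lambda>V. span (V \<union> W)"] S(4) by linarith
    show "dim V \<le> k + card W" if V: "V \<in> (\<lambda>V. span (V \<union> W)) ` S" for V
    proof -
      from V obtain V' where V': "V' \<in> S" "V = span (V' \<union> W)" by auto
      obtain B where B: "B \<subseteq> V'" "V' \<subseteq> span B" "card B = dim V'" "finite B"
        by (metis basis_exists independent_imp_finite)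
      have "V' \<union> W \<subseteq> span (B \<union> W)"
        using B(2) span_mono[of B "B \<union> W"] span_mono[of W "B \<union> W"] span_superset[of W] by blast
      then have "dim V \<le> card (B \<union> W)"
        using V'(2) B(4) W by (metis dim_le_card dim_span finite_Un)
      also have "\<dots> \<le> card B + card W" by (rule card_Un_le)
      finally show ?thesis using B(3) S(2)[OF V'(1)] by linarith
    qed
    show "Z \<subseteq> \<Union>((\<lambda>V. span (V \<union> W)) ` S)"
    proof
      fix z assume "z \<in> Z"
      then obtain x where x: "x \<in> X" "z - x \<in> span W" using Z by blast
      then obtain V where V: "V \<in> S" "x \<in> V" using S(3) by blast
      have "x \<in> span (V \<union> W)" "z - x \<in> span (V \<union> W)"
        using V(2) x(2) span_mono[of W "V \<union> W"] by (auto intro: span_base)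
      then have "x + (z - x) \<in> span (V \<union> W)" by (rule span_add)
      then show "z \<in> \<Union>((\<lambda>V. span (V \<union> W)) ` S)" using V(1) by auto
    qed
  qed (use S in auto)
qed

text \<open>\<open>F\<close> is an arbitrary family and coefficients belong to indices, not to
  vectors; thus every linear image of a box, injective or not, is again a box with the same
  sides.\<close>

definition lattice_box :: "'i set \<Rightarrow> ('i \<Rightarrow> 'a::real_vector) \<Rightarrow> ('i \<Rightarrow> real) \<Rightarrow> 'a set" where
  "lattice_box I F n = {\<Sum>i\<in>I. of_int (c i) *\<^sub>R F i | c :: 'i \<Rightarrow> int. \<forall>i\<in>I. \<bar>of_int (c i)\<bar> \<le> n i}"

lemma lattice_box_linear_image:
  fixes F :: "'i \<Rightarrow> 'a::real_vector"
  assumes "linear f"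
  shows "f ` lattice_box I F n = lattice_box I (f \<circ> F) n"
proof -
  have "f (\<Sum>i\<in>I. of_int (c i) *\<^sub>R F i) = (\<Sum>i\<in>I. of_int (c i) *\<^sub>R (f \<circ> F) i)" for c :: "'i \<Rightarrow> int"
    using assms by (simp add: linear_sum linear_scale)
  note eq = this
  show ?thesis unfolding lattice_box_def
    by (simp only: setcompr_eq_image image_image eq)
qed

lemma lattice_box_reindex:
  assumes h: "bij_betw h J I"
  shows "lattice_box I F n = lattice_box J (F \<circ> h) (n \<circ> h)"
proof
  show "lattice_box I F n \<subseteq> lattice_box J (F \<circ> h) (n \<circ> h)"
  proof
    fix x assume "x \<in> lattice_box I F n"
    then obtain c where c: "x = (\<Sum>i\<in>I. of_int (c i) *\<^sub>R F i)" "\<forall>i\<in>I. \<bar>real_of_int (c i)\<bar> \<le> n i"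
      unfolding lattice_box_def by blast
    have "x = (\<Sum>j\<in>J. of_int (c (h j)) *\<^sub>R F (h j))"
      unfolding c(1) using sum.reindex_bij_betw[OF h, of "\<lambda>i. of_int (c i) *\<^sub>R F i"] by simp
    moreover have "\<forall>j\<in>J. \<bar>real_of_int (c (h j))\<bar> \<le> n (h j)"
      using c(2) bij_betwE[OF h] by blast
    ultimately show "x \<in> lattice_box J (F \<circ> h) (n \<circ> h)" unfolding lattice_box_def by (intro CollectI exI[of _ "c \<circ> h"]) simp
  qed
next
  show "lattice_box J (F \<circ> h) (n \<circ> h) \<subseteq> lattice_box I F n"
  proof
    fix x assume "x \<in> lattice_box J (F \<circ> h) (n \<circ> h)"
    then obtain c where c: "x = (\<Sum>j\<in>J. of_int (c j) *\<^sub>R F (h j))" "\<forall>j\<in>J. \<bar>real_of_int (c j)\<bar> \<le> n (h j)"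
      unfolding lattice_box_def by auto
    define c' where "c' = c \<circ> inv_into J h"
    have c': "c' (h j) = c j" if "j \<in> J" for j
      using h that by (simp add: c'_def bij_betw_def)
    have "x = (\<Sum>i\<in>I. of_int (c' i) *\<^sub>R F i)"
      unfolding c(1) using sum.reindex_bij_betw[OF h, of "\<lambda>i. of_int (c' i) *\<^sub>R F i"] c' by simp
    moreover have "\<forall>i\<in>I. \<bar>real_of_int (c' i)\<bar> \<le> n i"
    proof
      fix i assume "i \<in> I"
      then obtain j where "j \<in> J" "i = h j" using h by (auto simp: bij_betw_def)
      then show "\<bar>real_of_int (c' i)\<bar> \<le> n i" using c(2) c' by simp
    qed
    ultimately show "x \<in> lattice_box I F n" unfolding lattice_box_def by blast
  qed
qed

text \<open>Each discarded coordinate is paid for by one dimension of the covering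
  subspaces.\<close>

lemma coverable_lattice_box_subset:
  assumes "finite I" "J \<subseteq> I" "coverable (lattice_box J F n) k t"
  shows "coverable (lattice_box I F n) (k + card (I - J)) t"
proof -
  have "coverable (lattice_box I F n) (k + card (F ` (I - J))) t"
  proof (rule coverable_plus_span[OF assms(3)])
    show "finite (F ` (I - J))" using assms(1) by simp
    fix z assume "z \<in> lattice_box I F n"
    then obtain c where c: "z = (\<Sum>i\<in>I. of_int (c i) *\<^sub>R F i)" "\<forall>i\<in>I. \<bar>real_of_int (c i)\<bar> \<le> n i"
      unfolding lattice_box_def by blast
    have "z - (\<Sum>i\<in>J. of_int (c i) *\<^sub>R F i) = (\<Sum>i\<in>I - J. of_int (c i) *\<^sub>R F i)"
      using assms(1,2) by (simp add: c(1) sum_diff)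
    also have "\<dots> \<in> span (F ` (I - J))" by (intro span_sum span_scale span_base) auto
    finally have "z - (\<Sum>i\<in>J. of_int (c i) *\<^sub>R F i) \<in> span (F ` (I - J))" .
    moreover have "(\<Sum>i\<in>J. of_int (c i) *\<^sub>R F i) \<in> lattice_box J F n"
      unfolding lattice_box_def using c(2) assms(2) by blast
    ultimately show "\<exists>x\<in>lattice_box J F n. z - x \<in> span (F ` (I - J))" by blast
  qed
  moreover have "card (F ` (I - J)) \<le> card (I - J)" using assms(1) by (simp add: card_image_le)
  ultimately show ?thesis using coverable_mono by (meson add_left_mono order_refl)
qed

text \<open>Two of the vectors, \<open>F i\<close> and \<open>F j\<close>, are independent modulo
  \<open>span X\<close>. A linear map that kills both and fixes \<open>X\<close> pointwise rewrites
  each point of \<open>X\<close> with the same coefficients and these two terms gone.\<close>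

lemma lattice_box_drop_two:
  fixes F :: "'i \<Rightarrow> 'a::euclidean_space"
  assumes I: "finite I" and F: "inj_on F I" "independent (F ` I)"
    and X: "X \<subseteq> lattice_box I F n" and dim: "dim X + 2 \<le> card I"
  shows "\<exists>i\<in>I. \<exists>j\<in>I - {i}. \<exists>F'::'i \<Rightarrow> 'a. X \<subseteq> lattice_box (I - {i, j}) F' n"
proof -
  have escape: "\<exists>i\<in>I. F i \<notin> span Y" if "dim Y < card I" for Y
  proof (rule ccontr)
    assume "\<not> (\<exists>i\<in>I. F i \<notin> span Y)"
    then have "F ` I \<subseteq> span Y" by auto
    then have "card (F ` I) \<le> dim (span Y)" using F(2) by (rule independent_card_le_dim)
    then show False using that F(1) by (simp add: card_image)
  qed
  obtain i where i: "i \<in> I" "F i \<notin> span X" using escape[of X] dim by auto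
  have "dim (insert (F i) X) = dim X + 1" using i by (simp add: dim_insert)
  then obtain j where j: "j \<in> I" "F j \<notin> span (insert (F i) X)"
    using escape[of "insert (F i) X"] dim by auto
  have ij: "j \<noteq> i" using j(2) by (metis insertI1 span_base)
  obtain B where B: "B \<subseteq> X" "independent B" "X \<subseteq> span B" by (metis basis_exists)
  have spB: "span B = span X"
    using span_mono[OF B(1)] span_minimal[OF B(3)] by (simp add: subset_antisym)
  have "F i \<notin> span B" using i spB by simp
  moreover have "F j \<notin> span (insert (F i) B)"
    using j(2) span_mono[of "insert (F i) B" "insert (F i) X"] B(1) by blast
  ultimately have ind: "independent (insert (F j) (insert (F i) B))"
    using B(2) by (auto simp: independent_insert)
  define h where "h v = (if v = F i \<or> v = F j then 0 else v)" for v
  obtain g where g: "linear g" "\<And>v. v \<in> insert (F j) (insert (F i) B) \<Longrightarrow> g v = h v"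
    using linear_independent_extend[OF ind, of h] by blast
  have gi: "g (F i) = 0" and gj: "g (F j) = 0" using g(2) by (auto simp: h_def)
  have gB: "g v = v" if "v \<in> B" for v
  proof -
    have "v \<noteq> F i" "v \<noteq> F j"
      using that i(2) j(2) B(1) span_base[of v X] span_base[of v "insert (F i) X"] by auto
    then show ?thesis using g(2) that by (simp add: h_def)
  qed
  have gX: "g x = x" if "x \<in> X" for x
    using linear_eq_on_span[OF g(1) linear_id, of B x] gB B(3) that by (auto simp: id_def)
  have "X \<subseteq> lattice_box (I - {i, j}) (g \<circ> F) n"
  proof
    fix x assume x: "x \<in> X"
    then obtain c where c: "x = (\<Sum>i\<in>I. of_int (c i) *\<^sub>R F i)" "\<forall>i\<in>I. \<bar>real_of_int (c i)\<bar> \<le> n i"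
      using X unfolding lattice_box_def by blast
    have "x = g x" using gX x by simp
    also have "\<dots> = (\<Sum>l\<in>I. of_int (c l) *\<^sub>R g (F l))"
      unfolding c(1) using g(1) by (simp add: linear_sum linear_scale)
    also have "\<dots> = (\<Sum>l\<in>I - {i, j}. of_int (c l) *\<^sub>R g (F l))"
      using I gi gj by (intro sum.mono_neutral_right) auto
    finally show "x \<in> lattice_box (I - {i, j}) (g \<circ> F) n" unfolding lattice_box_def using c(2) by auto
  qed
  then show ?thesis using i(1) j(1) ij by blast
qed

text \<open>Removing an element where \<^term>\<open>f\<close> is maximal, the induction step is the
  concavity of \<^term>\<open>\<lambda>x::real. x powr (1 - \<beta>)\<close>.\<close>

lemma sum_powr_le_of_linear_growth:
  fixes f :: "'b \<Rightarrow> real"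
  assumes "finite Y" and pos: "\<And>y. y \<in> Y \<Longrightarrow> f y > 0"
    and growth: "\<And>r. r > 0 \<Longrightarrow> real (card {y \<in> Y. f y \<le> r}) \<le> A * r"
    and \<beta>: "0 \<le> \<beta>" "\<beta> < 1" and A: "A > 0"
  shows "(\<Sum>y\<in>Y. f y powr (-\<beta>)) \<le> A powr \<beta> * real (card Y) powr (1 - \<beta>) / (1 - \<beta>)"
  using assms(1) pos growth
proof (induction "card Y" arbitrary: Y)
  case 0
  then show ?case by simp
next
  case (Suc N)
  then have "Y \<noteq> {}" by auto
  have "Max (f ` Y) \<in> f ` Y" using \<open>finite Y\<close> \<open>Y \<noteq> {}\<close> by (intro Max_in) auto
  then obtain y where y: "y \<in> Y" "f y = Max (f ` Y)" by auto
  then have ymax: "f z \<le> f y" if "z \<in> Y" for z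
    using \<open>finite Y\<close> that by simp
  define Y' where "Y' = Y - {y}"
  have cY': "N = card Y'" using Suc.hyps(2) y(1) Suc.prems(1) by (simp add: Y'_def)
  have IH: "(\<Sum>y\<in>Y'. f y powr (-\<beta>)) \<le> A powr \<beta> * real N powr (1 - \<beta>) / (1 - \<beta>)"
    unfolding cY'
  proof (rule Suc.hyps(1)[OF cY'])
    fix r :: real assume r: "r > 0"
    have "card {y \<in> Y'. f y \<le> r} \<le> card {y \<in> Y. f y \<le> r}"
      using Suc.prems(1) by (intro card_mono) (auto simp: Y'_def)
    then show "real (card {y \<in> Y'. f y \<le> r}) \<le> A * r" using Suc.prems(3)[OF r] by linarith
  qed (use Suc.prems in \<open>auto simp: Y'_def\<close>)
  have fy: "f y > 0" using Suc.prems(2) y(1) by blast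
  \<comment> \<open>All of \<open>Y\<close> lies below its maximum, so the growth hypothesis at
    \<open>r = f y\<close> bounds \<open>f y\<close> from below by
    \<open>card Y / A\<close>.\<close>
  have "{z \<in> Y. f z \<le> f y} = Y" using ymax by auto
  then have M: "real (Suc N) \<le> A * f y" using Suc.prems(3)[OF fy] Suc.hyps(2) by simp
  define M where "M = real (Suc N)"
  have M0: "M > 0" by (simp add: M_def)
  have "f y powr (-\<beta>) \<le> (M / A) powr (-\<beta>)"
    using M A \<beta> M0 by (intro powr_mono2') (auto simp: M_def field_simps)
  also have "\<dots> = A powr \<beta> * M powr (-\<beta>)"
    using A M0 by (simp add: powr_divide powr_minus field_simps)
  finally have 1: "f y powr (-\<beta>) \<le> A powr \<beta> * M powr (-\<beta>)" .
  \<comment> \<open>Young's inequality with weights \<open>1 - \<beta>\<close> and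
    \<open>\<beta>\<close> for \<open>N\<close> and \<open>M = N + 1\<close>, divided by
    \<open>M powr \<beta>\<close>.\<close>
  have 2: "real N powr (1 - \<beta>) + (1 - \<beta>) * M powr (-\<beta>) \<le> M powr (1 - \<beta>)"
  proof -
    have "real N powr (1 - \<beta>) * M powr \<beta> \<le> (1 - \<beta>) * real N + \<beta> * M"
    proof (cases "N = 0")
      case False
      then show ?thesis
        using Youngs_inequality_0[of "1 - \<beta>" \<beta> "real N" M] \<beta> M0 by (simp add: mult.commute)
    qed (use \<beta> M0 in simp)
    also have "\<dots> = M - (1 - \<beta>)" by (simp add: M_def algebra_simps)
    finally have "real N powr (1 - \<beta>) * M powr \<beta> * M powr (-\<beta>) \<le> (M - (1 - \<beta>)) * M powr (-\<beta>)"
      by (intro mult_right_mono) auto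
    moreover have "M powr \<beta> * M powr (-\<beta>) = 1" using M0 by (simp add: powr_minus)
    moreover have "M * M powr (-\<beta>) = M powr (1 - \<beta>)"
      using M0 by (metis less_eq_real_def powr_mult_base uminus_add_conv_diff add.commute)
    ultimately show ?thesis by (simp add: mult.assoc left_diff_distrib)
  qed
  have "(\<Sum>y\<in>Y. f y powr (-\<beta>)) = f y powr (-\<beta>) + (\<Sum>y\<in>Y'. f y powr (-\<beta>))"
    unfolding Y'_def using y(1) Suc.prems(1) by (simp add: sum.remove)
  also have "\<dots> \<le> A powr \<beta> * M powr (-\<beta>) + A powr \<beta> * real N powr (1 - \<beta>) / (1 - \<beta>)"
    using 1 IH by linarith
  also have "\<dots> = A powr \<beta> / (1 - \<beta>) * (real N powr (1 - \<beta>) + (1 - \<beta>) * M powr (-\<beta>))"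
    using \<beta> by (simp add: field_simps)
  also have "\<dots> \<le> A powr \<beta> / (1 - \<beta>) * M powr (1 - \<beta>)"
    using 2 \<beta> by (intro mult_left_mono) auto
  finally show ?case by (simp add: M_def Suc.hyps(2))
qed

subsection \<open>Diagonal grids and their duals\<close>

text \<open>For positive \<open>n\<close> this is the lattice spanned by the vectors
  \<open>(1 / n u) *\<^sub>R u\<close> with \<open>u\<close> in \<open>I\<close>. Its dual inside
  the same coordinate subspace is again a grid, with \<open>1 / n u\<close> in place of
  \<open>n u\<close>, so one counting lemma serves both sides.\<close>

definition grid :: "'a::euclidean_space set \<Rightarrow> ('a \<Rightarrow> real) \<Rightarrow> 'a set" where
  "grid I n = {x. (\<forall>u\<in>I. n u * (x \<bullet> u) \<in> \<int>) \<and> (\<forall>u\<in>Basis - I. x \<bullet> u = 0)}"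

lemma inner_sum_Basis:
  assumes "I \<subseteq> Basis" "u \<in> Basis"
  shows "(\<Sum>v\<in>I. f v *\<^sub>R v) \<bullet> u = (if u \<in> I then f u else 0)"
proof -
  have fin: "finite I" using assms(1) finite_subset[OF _ finite_Basis] by blast
  have "(\<Sum>v\<in>I. f v *\<^sub>R v) \<bullet> u = (\<Sum>v\<in>I. f v * (v \<bullet> u))" by (simp add: inner_sum_left)
  also have "\<dots> = (\<Sum>v\<in>I. if v = u then f v else 0)"
    using assms by (intro sum.cong) (auto simp: inner_Basis)
  finally show ?thesis using fin by simp
qed

lemma grid_sub: "x \<in> grid I n \<Longrightarrow> y \<in> grid I n \<Longrightarrow> x - y \<in> grid I n"
  by (auto simp: grid_def inner_diff_left right_diff_distrib)

lemma grid_add: "x \<in> grid I n \<Longrightarrow> y \<in> grid I n \<Longrightarrow> x + y \<in> grid I n"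
  by (auto simp: grid_def inner_add_left distrib_left)

lemma grid_zero: "0 \<in> grid I n"
  by (simp add: grid_def)

lemma grid_scale:
  assumes "x \<in> grid I n"
  shows "of_int k *\<^sub>R x \<in> grid I n"
proof -
  have "n u * (of_int k *\<^sub>R x \<bullet> u) = of_int k * (n u * (x \<bullet> u))" for u by simp
  then show ?thesis using assms by (auto simp only: grid_def mem_Collect_eq) simp_all
qed

lemma grid_sum:
  assumes "\<And>i. i \<in> S \<Longrightarrow> f i \<in> grid I n"
  shows "(\<Sum>i\<in>S. of_int (c i) *\<^sub>R f i) \<in> grid I n"
  using assms
  by (induction S rule: infinite_finite_induct) (simp_all add: grid_zero grid_add grid_scale)

lemma grid_eq_sum:
  assumes "I \<subseteq> Basis" "x \<in> grid I n"
  shows "x = (\<Sum>u\<in>I. (x \<bullet> u) *\<^sub>R u)"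
proof (rule euclidean_eqI)
  fix v :: 'a assume "v \<in> Basis"
  then show "x \<bullet> v = (\<Sum>u\<in>I. (x \<bullet> u) *\<^sub>R u) \<bullet> v"
    using assms(2) by (simp add: inner_sum_Basis[OF assms(1)] grid_def)
qed

lemma grid_inner:
  assumes "I \<subseteq> Basis" "x \<in> grid I n"
  shows "w \<bullet> x = (\<Sum>u\<in>I. (w \<bullet> u) * (x \<bullet> u))"
  by (subst grid_eq_sum[OF assms]) (simp add: inner_sum_right mult.commute)

text \<open>Duality of the two grids: in each coordinate the factors \<open>n u\<close> and
  \<open>1 / n u\<close> cancel.\<close>

lemma grid_inner_Ints:
  assumes I: "I \<subseteq> Basis" and n: "\<And>u. u \<in> I \<Longrightarrow> n u > 0"
    and x: "x \<in> grid I n" and w: "w \<in> grid I (\<lambda>u. 1 / n u)"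
  shows "w \<bullet> x \<in> \<int>"
  unfolding grid_inner[OF I x]
proof (rule Ints_sum)
  fix u assume u: "u \<in> I"
  have "(w \<bullet> u) * (x \<bullet> u) = (1 / n u * (w \<bullet> u)) * (n u * (x \<bullet> u))" using n[OF u] by simp
  also have "\<dots> \<in> \<int>"
  proof (rule Ints_mult)
    show "1 / n u * (w \<bullet> u) \<in> \<int>" using w u by (simp add: grid_def)
    show "n u * (x \<bullet> u) \<in> \<int>" using x u by (simp add: grid_def)
  qed
  finally show "(w \<bullet> u) * (x \<bullet> u) \<in> \<int>" .
qed

lemma grid_generator:
  assumes "I \<subseteq> Basis" "u \<in> I" "n u > 0"
  shows "(1 / n u) *\<^sub>R u \<in> grid I n"
proof -
  have "n v * ((1 / n u) *\<^sub>R u \<bullet> v) = (if v = u then 1 else 0)" if "v \<in> I" for v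
    using assms that by (auto simp: inner_Basis subset_eq)
  moreover have "u \<bullet> v = 0" if "v \<in> Basis - I" for v
    using assms that by (auto simp: inner_Basis subset_eq)
  ultimately show ?thesis unfolding grid_def by auto
qed

text \<open>Grid points are counted by independent choices of integer coordinates. The floor is
  applied to integers only and merely changes the type. Different \<open>A\<close> give symmetric
  cubes, one-sided windows and windows with 0 removed.\<close>

lemma grid_window:
  fixes A :: "'a::euclidean_space \<Rightarrow> int set"
  assumes I: "I \<subseteq> Basis" and n: "\<And>u. u \<in> I \<Longrightarrow> n u > 0" and A: "\<And>u. u \<in> I \<Longrightarrow> finite (A u)"
  defines "W \<equiv> {x \<in> grid I n. \<forall>u\<in>I. \<lfloor>n u * (x \<bullet> u)\<rfloor> \<in> A u}"
  shows "finite W" and "card W = (\<Prod>u\<in>I. card (A u))"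
proof -
  have fin: "finite I" using I finite_subset[OF _ finite_Basis] by blast
  define p where "p f = (\<Sum>u\<in>I. (of_int (f u) / n u) *\<^sub>R u)" for f :: "'a \<Rightarrow> int"
  have pu: "p f \<bullet> u = (if u \<in> I then of_int (f u) / n u else 0)" if "u \<in> Basis" for f u
    unfolding p_def using I that by (rule inner_sum_Basis)
  have npu: "n u * (p f \<bullet> u) = of_int (f u)" if "u \<in> I" for f u
  proof -
    have "u \<in> Basis" using I that by blast
    then show ?thesis using pu[of u f] n[OF that] that by simp
  qed
  have bij: "bij_betw p (PiE I A) W"
  proof (rule bij_betwI[where g = "\<lambda>x. restrict (\<lambda>u. \<lfloor>n u * (x \<bullet> u)\<rfloor>) I"])
    show "p \<in> PiE I A \<rightarrow> W"
    proof
      fix f assume "f \<in> PiE I A"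
      then have "p f \<in> grid I n" "\<forall>u\<in>I. \<lfloor>n u * (p f \<bullet> u)\<rfloor> \<in> A u"
        by (simp_all add: grid_def npu pu PiE_mem)
      then show "p f \<in> W" by (simp add: W_def)
    qed
    show "(\<lambda>x. restrict (\<lambda>u. \<lfloor>n u * (x \<bullet> u)\<rfloor>) I) \<in> W \<rightarrow> PiE I A"
      by (simp add: W_def Pi_def)
    show "restrict (\<lambda>u. \<lfloor>n u * (p f \<bullet> u)\<rfloor>) I = f" if "f \<in> PiE I A" for f
    proof
      fix u show "restrict (\<lambda>u. \<lfloor>n u * (p f \<bullet> u)\<rfloor>) I u = f u"
        using PiE_arb[OF that, of u] by (cases "u \<in> I") (simp_all add: npu)
    qed
    show "p (restrict (\<lambda>u. \<lfloor>n u * (x \<bullet> u)\<rfloor>) I) = x" if "x \<in> W" for x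
    proof (rule euclidean_eqI)
      fix u :: 'a assume u: "u \<in> Basis"
      show "p (restrict (\<lambda>u. \<lfloor>n u * (x \<bullet> u)\<rfloor>) I) \<bullet> u = x \<bullet> u"
      proof (cases "u \<in> I")
        case True
        then have "n u * (x \<bullet> u) \<in> \<int>"
          using \<open>x \<in> W\<close> by (simp add: W_def grid_def)
        then have eq: "of_int \<lfloor>n u * (x \<bullet> u)\<rfloor> = n u * (x \<bullet> u)"
          by (simp only: of_int_floor)
        have "p (restrict (\<lambda>u. \<lfloor>n u * (x \<bullet> u)\<rfloor>) I) \<bullet> u = of_int \<lfloor>n u * (x \<bullet> u)\<rfloor> / n u"
          using True by (simp add: pu[OF u])
        then show ?thesis using n[OF True] unfolding eq by simp
      next
        case False
        then show ?thesis using \<open>x \<in> W\<close> u by (simp add: pu[OF u] W_def grid_def)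
      qed
    qed
  qed
  have "finite (PiE I A)" using fin A by (intro finite_PiE)
  then show "finite W" using bij_betw_finite[OF bij] by blast
  show "card W = (\<Prod>u\<in>I. card (A u))" using bij_betw_same_card[OF bij] card_PiE[OF fin, of A] by simp
qed

lemma abs_le_iff_floor_window:
  assumes "(z::real) \<in> \<int>"
  shows "\<bar>z\<bar> \<le> r \<longleftrightarrow> \<lfloor>z\<rfloor> \<in> {-\<lfloor>r\<rfloor>..\<lfloor>r\<rfloor>}"
proof -
  from assms obtain k where "z = of_int k" by (auto elim: Ints_cases)
  then have "\<bar>z\<bar> \<le> r \<longleftrightarrow> of_int \<bar>k\<bar> \<le> r" by simp
  also have "\<dots> \<longleftrightarrow> \<bar>k\<bar> \<le> \<lfloor>r\<rfloor>" by (simp only: le_floor_iff)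
  also have "\<dots> \<longleftrightarrow> k \<in> {-\<lfloor>r\<rfloor>..\<lfloor>r\<rfloor>}" by auto
  finally show ?thesis using \<open>z = of_int k\<close> by simp
qed

lemma real_card_floor_window:
  assumes "r \<ge> 0"
  shows "real (card {-\<lfloor>r\<rfloor>..\<lfloor>r\<rfloor>}) \<le> 2 * r + 1"
  using assms of_int_floor_le[of r] by simp

lemma grid_ball:
  assumes I: "I \<subseteq> Basis" and n: "\<And>u. u \<in> I \<Longrightarrow> n u > 0" and r: "r \<ge> 0"
  shows "finite {x \<in> grid I n. \<forall>u\<in>I. \<bar>x \<bullet> u\<bar> \<le> r}"
    and "real (card {x \<in> grid I n. \<forall>u\<in>I. \<bar>x \<bullet> u\<bar> \<le> r}) \<le> (\<Prod>u\<in>I. 2 * (r * n u) + 1)"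
proof -
  define A where "A u = {-\<lfloor>r * n u\<rfloor>..\<lfloor>r * n u\<rfloor>}" for u
  have "\<bar>x \<bullet> u\<bar> \<le> r \<longleftrightarrow> \<lfloor>n u * (x \<bullet> u)\<rfloor> \<in> A u" if "u \<in> I" "x \<in> grid I n" for x u
  proof -
    have "\<bar>x \<bullet> u\<bar> \<le> r \<longleftrightarrow> \<bar>n u * (x \<bullet> u)\<bar> \<le> r * n u"
      using n[OF that(1)] by (simp add: abs_mult mult.commute)
    then show ?thesis using abs_le_iff_floor_window[of "n u * (x \<bullet> u)" "r * n u"] that
      by (simp add: A_def grid_def)
  qed
  then have eq: "{x \<in> grid I n. \<forall>u\<in>I. \<bar>x \<bullet> u\<bar> \<le> r} = {x \<in> grid I n. \<forall>u\<in>I. \<lfloor>n u * (x \<bullet> u)\<rfloor> \<in> A u}"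
    by blast
  have fA: "finite (A u)" for u by (simp add: A_def)
  show "finite {x \<in> grid I n. \<forall>u\<in>I. \<bar>x \<bullet> u\<bar> \<le> r}"
    unfolding eq using I n fA by (rule grid_window(1))
  have "real (card {x \<in> grid I n. \<forall>u\<in>I. \<bar>x \<bullet> u\<bar> \<le> r}) = (\<Prod>u\<in>I. real (card (A u)))"
    unfolding eq by (subst grid_window(2)[OF I n fA]) auto
  also have "\<dots> \<le> (\<Prod>u\<in>I. 2 * (r * n u) + 1)"
  proof (intro prod_mono conjI)
    fix u assume "u \<in> I"
    then have "0 \<le> r * n u" using n r by (simp add: less_imp_le)
    then show "real (card (A u)) \<le> 2 * (r * n u) + 1"
      unfolding A_def by (rule real_card_floor_window)
  qed simp
  finally show "real (card {x \<in> grid I n. \<forall>u\<in>I. \<bar>x \<bullet> u\<bar> \<le> r}) \<le> (\<Prod>u\<in>I. 2 * (r * n u) + 1)" .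
qed

lemma discrete_subgroup_grid:
  assumes I: "I \<subseteq> Basis" and n: "\<And>u. u \<in> I \<Longrightarrow> n u > 0"
  shows "discrete_subgroup (grid I n)"
  unfolding discrete_subgroup_def
proof (intro conjI ballI allI)
  fix r :: real
  have "grid I n \<inter> cball 0 r \<subseteq> {x \<in> grid I n. \<forall>u\<in>I. \<bar>x \<bullet> u\<bar> \<le> \<bar>r\<bar>}"
  proof (intro subsetI CollectI conjI ballI)
    fix x u :: 'a assume x: "x \<in> grid I n \<inter> cball 0 r" and u: "u \<in> I"
    have "\<bar>x \<bullet> u\<bar> \<le> norm x" using I u Basis_le_norm by blast
    moreover have "norm x \<le> r" using x by simp
    ultimately show "\<bar>x \<bullet> u\<bar> \<le> \<bar>r\<bar>" by linarith
  qed simp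
  moreover have "finite {x \<in> grid I n. \<forall>u\<in>I. \<bar>x \<bullet> u\<bar> \<le> \<bar>r\<bar>}"
    by (rule grid_ball(1)[OF I n]) simp_all
  ultimately show "finite (grid I n \<inter> cball 0 r)" by (rule finite_subset)
qed (simp_all add: grid_zero grid_sub)

text \<open>Siegel's lemma: dual vectors with coordinates in \<open>[0, T]\<close> outnumber the
  integers that \<open>w \<bullet> x\<close> can attain, so two of them agree on \<open>x\<close>
  and their difference annihilates it.\<close>

lemma grid_annihilator:
  fixes n :: "'a::euclidean_space \<Rightarrow> real"
  assumes I: "I \<subseteq> Basis" and m: "card I = m" "m \<ge> 2" and n: "\<And>u. u \<in> I \<Longrightarrow> n u > 0"
    and \<alpha>: "\<alpha> \<ge> 1" "\<alpha> ^ (m - 1) = (\<Prod>u\<in>I. n u)"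
    and x: "x \<in> grid I n" "\<And>u. u \<in> I \<Longrightarrow> \<bar>x \<bullet> u\<bar> \<le> 1"
  shows "\<exists>w\<in>grid I (\<lambda>u. 1 / n u). w \<noteq> 0 \<and> w \<bullet> x = 0 \<and> (\<forall>u\<in>I. \<bar>w \<bullet> u\<bar> \<le> real (2 * m + 1) * \<alpha>)"
proof -
  \<comment> \<open>The factor \<open>2 * m + 1\<close> decides the pigeonhole count: there are at
    least \<open>(2 * m + 1) ^ m * \<alpha>\<close> vectors and fewer than
    \<open>(2 * m + 1) ^ 2 * \<alpha>\<close> values.\<close>
  define T where "T = real (2 * m + 1) * \<alpha>"
  have T: "T > 0" using \<alpha> by (simp add: T_def add_nonneg_pos)
  \<comment> \<open>Windows starting at 0 keep differences within \<open>T\<close>; counting 0 makes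
    their size at least \<open>T / n u\<close>, also when \<open>n u > T\<close>.\<close>
  define A where "A u = {0..\<lfloor>T / n u\<rfloor>}" for u
  define W where "W = {w \<in> grid I (\<lambda>u. 1 / n u). \<forall>u\<in>I. \<lfloor>1 / n u * (w \<bullet> u)\<rfloor> \<in> A u}"
  have n': "\<And>u. u \<in> I \<Longrightarrow> 1 / n u > 0" using n by simp
  have fA: "finite (A u)" for u by (simp add: A_def)
  have finW: "finite W" and cardW: "card W = (\<Prod>u\<in>I. card (A u))"
    unfolding W_def using grid_window[OF I n' fA] by auto
  have Wu: "0 \<le> w \<bullet> u \<and> w \<bullet> u \<le> T" if "w \<in> W" "u \<in> I" for w u
  proof -
    have "1 / n u * (w \<bullet> u) \<in> \<int>" and fl: "\<lfloor>1 / n u * (w \<bullet> u)\<rfloor> \<in> A u"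
      using that by (auto simp: W_def grid_def)
    then have "of_int \<lfloor>1 / n u * (w \<bullet> u)\<rfloor> = 1 / n u * (w \<bullet> u)"
      by (simp only: of_int_floor)
    moreover have "0 \<le> \<lfloor>1 / n u * (w \<bullet> u)\<rfloor>" "\<lfloor>1 / n u * (w \<bullet> u)\<rfloor> \<le> \<lfloor>T / n u\<rfloor>"
      using fl by (auto simp: A_def)
    ultimately have "0 \<le> 1 / n u * (w \<bullet> u)" "1 / n u * (w \<bullet> u) \<le> T / n u"
      by linarith+
    then show ?thesis using n[OF that(2)] by (auto simp: field_simps)
  qed
  have "real (2 * m + 1) ^ m * \<alpha> = (\<Prod>u\<in>I. T / n u)"
  proof -
    have "\<alpha> ^ m = \<alpha> * (\<Prod>u\<in>I. n u)" using \<alpha>(2) m(2) by (cases m) auto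
    moreover have "(\<Prod>u\<in>I. n u) > 0" using n by (intro prod_pos) auto
    ultimately show ?thesis
      using m(1) by (simp add: prod_dividef T_def power_mult_distrib)
  qed
  also have "\<dots> \<le> (\<Prod>u\<in>I. real (card (A u)))"
  proof (intro prod_mono conjI)
    fix u assume u: "u \<in> I"
    show "0 \<le> T / n u" using T n[OF u] by simp
    then have "0 \<le> \<lfloor>T / n u\<rfloor>" by simp
    then show "T / n u \<le> real (card (A u))" unfolding A_def by simp
  qed
  also have "\<dots> = real (card W)" by (simp add: cardW)
  finally have big: "real (2 * m + 1) ^ m * \<alpha> \<le> real (card W)" .
  define f where "f w = \<lfloor>w \<bullet> x\<rfloor>" for w
  have wx: "w \<bullet> x \<in> \<int>" if "w \<in> W" for w
    using grid_inner_Ints[OF I n x(1)] that by (simp add: W_def)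
  have "f ` W \<subseteq> {-\<lfloor>m * T\<rfloor>..\<lfloor>m * T\<rfloor>}"
  proof
    fix z assume "z \<in> f ` W"
    then obtain w where w: "w \<in> W" "z = f w" by auto
    have "\<bar>w \<bullet> x\<bar> \<le> (\<Sum>u\<in>I. \<bar>(w \<bullet> u) * (x \<bullet> u)\<bar>)"
      unfolding grid_inner[OF I x(1)] by (rule sum_abs)
    also have "\<dots> \<le> (\<Sum>u\<in>I. T * 1)"
      unfolding abs_mult using Wu[OF w(1)] x(2) T by (intro sum_mono mult_mono) auto
    also have "\<dots> = m * T" using m by simp
    finally show "z \<in> {-\<lfloor>m * T\<rfloor>..\<lfloor>m * T\<rfloor>}"
      unfolding w(2) f_def using abs_le_iff_floor_window[OF wx[OF w(1)]] by blast
  qed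
  then have "card (f ` W) \<le> card {-\<lfloor>m * T\<rfloor>..\<lfloor>m * T\<rfloor>}" by (intro card_mono) auto
  then have "real (card (f ` W)) \<le> 2 * (m * T) + 1"
    using real_card_floor_window[of "m * T"] T by (smt (verit) mult_nonneg_nonneg of_nat_0_le_iff of_nat_mono)
  also have "\<dots> \<le> (2 * real m * (2 * real m + 1) + 1) * \<alpha>" unfolding T_def using \<alpha>(1) by (simp add: algebra_simps)
  also have "\<dots> < real (2 * m + 1) ^ 2 * \<alpha>" using \<alpha>(1) m(2) by (simp add: power2_eq_square algebra_simps)
  also have "\<dots> \<le> real (2 * m + 1) ^ m * \<alpha>"
    using \<alpha>(1) m(2) by (intro mult_right_mono power_increasing) auto
  also note big
  finally have "\<not> inj_on f W" by (intro pigeonhole) simp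
  then obtain w1 w2 where w: "w1 \<in> W" "w2 \<in> W" "w1 \<noteq> w2" "f w1 = f w2" by (auto simp: inj_on_def)
  show ?thesis
  proof (intro bexI[of _ "w1 - w2"] conjI ballI)
    show "w1 - w2 \<noteq> 0" using w by simp
    have "of_int (f w1) = w1 \<bullet> x" "of_int (f w2) = w2 \<bullet> x"
      unfolding f_def using wx w(1,2) by (simp_all only: of_int_floor)
    then have "w1 \<bullet> x = w2 \<bullet> x" using w(4) by simp
    then show "(w1 - w2) \<bullet> x = 0" by (simp add: inner_diff_left)
    show "\<bar>(w1 - w2) \<bullet> u\<bar> \<le> real (2 * m + 1) * \<alpha>" if "u \<in> I" for u
      using Wu[OF w(1) that] Wu[OF w(2) that] unfolding T_def inner_diff_left by linarith
    show "w1 - w2 \<in> grid I (\<lambda>u. 1 / n u)" using w(1,2) by (auto simp: W_def grid_sub)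
  qed
qed

text \<open>A generator, up to sign, of the points of \<open>L\<close> on its line. Comparing real
  multiples replaces the usual condition of coprime coordinates.\<close>

definition primitive :: "'a::real_vector set \<Rightarrow> 'a \<Rightarrow> bool" where
  "primitive L w \<longleftrightarrow> w \<in> L \<and> w \<noteq> 0 \<and> (\<forall>t. t *\<^sub>R w \<in> L \<longrightarrow> t \<noteq> 0 \<longrightarrow> 1 \<le> \<bar>t\<bar>)"

text \<open>Such a multiple defines the same hyperplane and is no larger, so annihilators may be
  taken primitive. It is a shortest nonzero point of \<open>L\<close> on the line through
  \<open>w\<close>.\<close>

lemma primitive_multiple_exists:
  assumes L: "discrete_subgroup L" and w: "w \<in> L" "w \<noteq> 0"
  shows "\<exists>t. \<bar>t\<bar> \<le> 1 \<and> t \<noteq> 0 \<and> primitive L (t *\<^sub>R w)"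
proof -
  have "discrete_subgroup (L \<inter> span {w})"
    unfolding discrete_subgroup_def
  proof (intro conjI ballI allI)
    fix r
    have "L \<inter> span {w} \<inter> cball 0 r \<subseteq> L \<inter> cball 0 r" by blast
    then show "finite (L \<inter> span {w} \<inter> cball 0 r)"
      using L finite_subset unfolding discrete_subgroup_def by blast
  qed (use L in \<open>auto simp: discrete_subgroup_def span_zero span_diff\<close>)
  moreover have "w \<in> L \<inter> span {w}" using w by (simp add: span_base)
  ultimately obtain v where v: "v \<in> L \<inter> span {w}" "v \<noteq> 0"
    "\<And>x. x \<in> L \<inter> span {w} \<Longrightarrow> x \<noteq> 0 \<Longrightarrow> norm v \<le> norm x"
    using discrete_subgroup_shortest w(2) by metis
  obtain t where t: "v = t *\<^sub>R w" using v(1) by (auto simp: span_singleton)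
  have "\<bar>t\<bar> \<le> 1"
  proof -
    have "norm v \<le> norm w" using v(3)[of w] w by (auto simp: span_base)
    then show ?thesis using t w(2) by simp
  qed
  moreover have "t \<noteq> 0" using t v(2) by auto
  moreover have "primitive L v"
    unfolding primitive_def
  proof (intro conjI allI impI)
    fix s assume s: "s *\<^sub>R v \<in> L" "s \<noteq> (0::real)"
    then have "norm v \<le> norm (s *\<^sub>R v)" using v by (intro v(3)) (auto intro: span_scale)
    then show "1 \<le> \<bar>s\<bar>" using v(2) by simp
  qed (use v in auto)
  ultimately show ?thesis using t by blast
qed

text \<open>The values of \<open>w\<close> on the grid form a subgroup of the integers. Its
  generator \<open>g\<close> divides all coordinates of \<open>w\<close> relative to the dual grid,
  so \<open>w / g\<close> is a dual vector and primitivity forces \<open>g = 1\<close>.\<close>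

lemma primitive_grid_surj:
  assumes I: "I \<subseteq> Basis" and n: "\<And>u. u \<in> I \<Longrightarrow> n u > 0"
    and w: "primitive (grid I (\<lambda>u. 1 / n u)) w"
  shows "\<exists>x\<in>grid I n. w \<bullet> x = of_int l"
proof -
  have wg: "w \<in> grid I (\<lambda>u. 1 / n u)" and w0: "w \<noteq> 0"
    and wt: "\<And>t. t *\<^sub>R w \<in> grid I (\<lambda>u. 1 / n u) \<Longrightarrow> t \<noteq> 0 \<Longrightarrow> 1 \<le> \<bar>t\<bar>"
    using w unfolding primitive_def by blast+
  define A where "A = {k::int. \<exists>x\<in>grid I n. w \<bullet> x = of_int k}"
  have Asub: "a - q * b \<in> A" if ab: "a \<in> A" "b \<in> A" for a b q
  proof -
    obtain x where x: "x \<in> grid I n" "w \<bullet> x = of_int a" using ab(1) unfolding A_def by blast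
    obtain y where y: "y \<in> grid I n" "w \<bullet> y = of_int b" using ab(2) unfolding A_def by blast
    have "x - of_int q *\<^sub>R y \<in> grid I n" by (intro grid_sub grid_scale x y)
    moreover have "w \<bullet> (x - of_int q *\<^sub>R y) = of_int (a - q * b)"
      by (simp add: inner_diff_right x y)
    ultimately show ?thesis unfolding A_def by blast
  qed
  have "w \<bullet> 0 = of_int 0" by simp
  then have A0: "0 \<in> A" unfolding A_def using grid_zero[of I n] by blast
  \<comment> \<open>The dual coordinates of \<open>w\<close> are its values on the generators of the
    grid.\<close>
  have coord: "\<exists>k\<in>A. of_int k = (w \<bullet> u) / n u" if "u \<in> I" for u
  proof -
    have gen: "(1 / n u) *\<^sub>R u \<in> grid I n" using grid_generator I that n by blast
    have "w \<bullet> ((1 / n u) *\<^sub>R u) \<in> \<int>"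
      using grid_inner_Ints[OF I n gen wg] by simp
    then obtain k where k: "w \<bullet> ((1 / n u) *\<^sub>R u) = of_int k" by (rule Ints_cases)
    have "k \<in> A" unfolding A_def using gen k by blast
    moreover have "of_int k = (w \<bullet> u) / n u" using k by simp
    ultimately show ?thesis by blast
  qed
  obtain u where u: "u \<in> I" "w \<bullet> u \<noteq> 0"
  proof -
    have "\<exists>u\<in>I. w \<bullet> u \<noteq> 0"
    proof (rule ccontr)
      assume "\<not> (\<exists>u\<in>I. w \<bullet> u \<noteq> 0)"
      then have "(\<Sum>u\<in>I. (w \<bullet> u) *\<^sub>R u) = 0" by simp
      then show False using grid_eq_sum[OF I wg] w0 by simp
    qed
    then show ?thesis using that by blast
  qed
  obtain k where k: "k \<in> A" "k \<noteq> 0"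
  proof -
    obtain k where "k \<in> A" "of_int k = (w \<bullet> u) / n u" using coord[OF u(1)] by blast
    moreover have "(w \<bullet> u) / n u \<noteq> 0" using u n[OF u(1)] by simp
    ultimately show ?thesis using that by force
  qed
  have "\<exists>k\<in>A. k > 0"
  proof (cases "k > 0")
    case False
    then show ?thesis using Asub[OF A0 k(1), of 1] k(2) by (intro bexI[of _ "- k"]) auto
  qed (use k in blast)
  then obtain k' where k': "k' \<in> A" "k' > 0" by blast
  define g where "g = (LEAST g::nat. g > 0 \<and> int g \<in> A)"
  have ex: "nat k' > 0 \<and> int (nat k') \<in> A" using k' by simp
  have g: "g > 0" "int g \<in> A" using LeastI[of "\<lambda>g. g > 0 \<and> int g \<in> A", OF ex] unfolding g_def by blast+
  have gdvd: "int g dvd a" if "a \<in> A" for a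
  proof (rule ccontr)
    assume nd: "\<not> int g dvd a"
    have "a - (a div int g) * int g = a mod int g" by (simp add: minus_div_mult_eq_mod)
    then have m: "a mod int g \<in> A" using Asub[OF that g(2), of "a div int g"] by simp
    have "a mod int g \<noteq> 0" using nd by (simp add: dvd_eq_mod_eq_0)
    moreover have "a mod int g \<ge> 0" using g(1) by simp
    ultimately have pos: "a mod int g > 0" by linarith
    have "nat (a mod int g) > 0 \<and> int (nat (a mod int g)) \<in> A" using m pos by simp
    then have "g \<le> nat (a mod int g)" unfolding g_def by (rule Least_le)
    moreover have "a mod int g < int g" using g(1) by simp
    ultimately show False using pos by linarith
  qed
  have "(1 / real g) *\<^sub>R w \<in> grid I (\<lambda>u. 1 / n u)"
    unfolding grid_def
  proof (intro CollectI conjI ballI)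
    fix u assume "u \<in> I"
    then obtain a where a: "a \<in> A" "of_int a = (w \<bullet> u) / n u" using coord by blast
    then obtain b where "a = int g * b" using gdvd by blast
    then have "(w \<bullet> u) / n u = real g * of_int b" using a(2) by simp
    then have "1 / n u * ((1 / real g) *\<^sub>R w \<bullet> u) = of_int b" using g(1) by (simp add: field_simps)
    then show "1 / n u * ((1 / real g) *\<^sub>R w \<bullet> u) \<in> \<int>" by simp
  next
    fix u assume "u \<in> Basis - I"
    then show "(1 / real g) *\<^sub>R w \<bullet> u = 0" using wg by (simp add: grid_def)
  qed
  then have "1 \<le> \<bar>1 / real g\<bar>" using g(1) by (intro wt) simp_all
  then have "g = 1" using g(1) by (simp add: field_simps)
  then have "1 \<in> A" using g(2) by simp
  then have "l \<in> A" using Asub[OF A0, of 1 "- l"] by simp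
  then show ?thesis by (auto simp: A_def)
qed

subsection \<open>Counting in grids\<close>

text \<open>The section is strictly smaller than the coordinate subspace, since \<open>w\<close>
  itself lies in the latter only.\<close>

lemma dim_hyperplane_coordinate_le:
  fixes w :: "'a::euclidean_space"
  assumes I: "I \<subseteq> Basis" and w: "w \<noteq> 0" "\<And>u. u \<in> Basis - I \<Longrightarrow> w \<bullet> u = 0"
  shows "dim {v. (\<forall>u\<in>Basis - I. v \<bullet> u = 0) \<and> w \<bullet> v = 0} < card I"
proof -
  define V where "V = {v. (\<forall>u\<in>Basis - I. v \<bullet> u = 0) \<and> w \<bullet> v = 0}"
  define W where "W = {v::'a. \<forall>u\<in>Basis - I. v \<bullet> u = 0}"
  have fin: "finite I" using I finite_subset[OF _ finite_Basis] by blast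
  have sV: "subspace V"
    unfolding V_def subspace_def by (simp add: inner_add_left inner_add_right)
  have sW: "subspace W"
    unfolding W_def subspace_def by (simp add: inner_add_left)
  have "w \<in> W" using w(2) by (simp add: W_def)
  moreover have "w \<notin> V" using w(1) by (simp add: V_def)
  moreover have "V \<subseteq> W" by (auto simp: V_def W_def)
  ultimately have "span V \<subset> span W"
    using sV sW by (metis psubsetI span_eq_iff)
  then have "dim V < dim W" by (rule dim_psubset)
  also have "dim W \<le> card I"
  proof (rule dim_le_card[OF _ fin])
    show "W \<subseteq> span I"
    proof
      fix v assume v: "v \<in> W"
      have "v = (\<Sum>u\<in>I. (v \<bullet> u) *\<^sub>R u)"
      proof (rule euclidean_eqI)
        fix b :: 'a assume "b \<in> Basis"
        then show "v \<bullet> b = (\<Sum>u\<in>I. (v \<bullet> u) *\<^sub>R u) \<bullet> b"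
          using v by (simp add: inner_sum_Basis[OF I] W_def)
      qed
      moreover have "(\<Sum>u\<in>I. (v \<bullet> u) *\<^sub>R u) \<in> span I"
        by (intro span_sum span_scale span_base)
      ultimately show "v \<in> span I" by simp
    qed
  qed
  finally show ?thesis by (simp add: V_def)
qed

text \<open>The factor \<^term>\<open>\<bar>w \<bullet> u0\<bar>\<close> is gained by packing: every level set \<open>w \<bullet> x = l\<close> with
  \<open>0 \<le> l \<le> \<bar>w \<bullet> u0\<bar>\<close> contains a grid point near the origin, and the corresponding translates of
  the boxes spanned by \<^term>\<open>B\<close> are disjoint.\<close>

lemma grid_hyperplane_packing:
  fixes n :: "'a::euclidean_space \<Rightarrow> real"
  assumes I: "I \<subseteq> Basis" and m: "card I = m" and n: "\<And>u. u \<in> I \<Longrightarrow> n u \<ge> 1"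
    and w: "primitive (grid I (\<lambda>u. 1 / n u)) w"
    and u0: "u0 \<in> I" "w \<bullet> u0 \<noteq> 0"
    and B: "B \<subseteq> grid I n" "\<And>b. b \<in> B \<Longrightarrow> w \<bullet> b = 0" "independent B" "card B = m - 1"
    and N: "\<And>b. b \<in> B \<Longrightarrow> N b \<ge> 1" "\<And>b. b \<in> B \<Longrightarrow> N b * norm b \<le> C"
    and C: "C \<ge> 0"
  shows "\<bar>w \<bullet> u0\<bar> * (\<Prod>b\<in>B. N b) \<le> (3 * (1 + 2 * real m * C)) ^ m * (\<Prod>u\<in>I. n u)"
proof -
  \<comment> \<open>Sup norm bound for the packed points: 1 from the shift along \<open>u0\<close>,
    and \<open>2 * C\<close> from each basis vector, whose coefficient is at most
    \<open>1 + N b \<le> 2 * N b\<close>.\<close>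
  define R where "R = 1 + 2 * real m * C"
  have R: "R \<ge> 1" using C by (simp add: R_def)
  have finB: "finite B" using B(3) by (rule independent_imp_finite)
  have n0: "\<And>u. u \<in> I \<Longrightarrow> n u > 0" using n by force
  have wg: "w \<in> grid I (\<lambda>u. 1 / n u)" and w0: "w \<noteq> 0"
    using w unfolding primitive_def by blast+
  define V where "V = {v. (\<forall>u\<in>Basis - I. v \<bullet> u = 0) \<and> w \<bullet> v = 0}"
  have "dim V < card I"
    unfolding V_def using I w0 wg by (intro dim_hyperplane_coordinate_le) (simp_all add: grid_def)
  then have dimV: "dim V \<le> card B" using B(4) m by linarith
  have "B \<subseteq> V" using B(1,2) unfolding V_def grid_def by blast
  \<comment> \<open>\<open>B\<close> has as many elements as the dimension of \<open>V\<close>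
    allows, so it spans \<open>V\<close>.\<close>
  then have VB: "V \<subseteq> span B" using B(3) dimV by (rule card_ge_dim_independent)
  define G where "G = {x \<in> grid I n. \<forall>u\<in>I. \<bar>x \<bullet> u\<bar> \<le> R}"
  have finG: "finite G" unfolding G_def using R by (intro grid_ball(1)[OF I n0]) simp_all
  have "real (card G) \<le> (\<Prod>u\<in>I. 2 * (R * n u) + 1)"
    unfolding G_def using R by (intro grid_ball(2)[OF I n0]) simp_all
  also have "\<dots> \<le> (\<Prod>u\<in>I. (3 * R) * n u)"
  proof (intro prod_mono conjI)
    fix u assume u: "u \<in> I"
    \<comment> \<open>This absorbs the additive 1 of the count and produces the constant 3.\<close>
    have "1 * 1 \<le> R * n u" using R n[OF u] by (intro mult_mono) simp_all
    then show "0 \<le> 2 * (R * n u) + 1" "2 * (R * n u) + 1 \<le> 3 * R * n u" by simp_all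
  qed
  also have "\<dots> = (3 * R) ^ m * (\<Prod>u\<in>I. n u)"
    using m by (simp add: prod.distrib)
  finally have cardG: "real (card G) \<le> (3 * R) ^ m * (\<Prod>u\<in>I. n u)" .
  \<comment> \<open>A point at level \<open>l\<close> differs from
    \<open>(l / (w \<bullet> u0)) *\<^sub>R u0\<close> by an element of \<open>span B\<close>;
    reducing its coefficients modulo 1 moves the point near the origin within its level.\<close>
  have level: "\<forall>l::int. \<exists>x. x \<in> grid I n \<and> w \<bullet> x = of_int l \<and> (\<exists>t. (\<forall>b\<in>B. 0 \<le> t b \<and> t b \<le> 1) \<and>
          x = (\<Sum>b\<in>B. t b *\<^sub>R b) + (of_int l / (w \<bullet> u0)) *\<^sub>R u0)"
  proof
    fix l :: int
    obtain x where x: "x \<in> grid I n" "w \<bullet> x = of_int l"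
      using primitive_grid_surj[OF I n0 w] by blast
    define y where "y = x - (of_int l / (w \<bullet> u0)) *\<^sub>R u0"
    have "w \<bullet> y = 0" using x(2) u0(2) by (simp add: y_def inner_diff_right)
    moreover have "y \<bullet> u = 0" if u: "u \<in> Basis - I" for u
    proof -
      have "u0 \<in> Basis" "u0 \<noteq> u" using u u0(1) I by blast+
      then have "u0 \<bullet> u = 0" using u by (simp add: inner_not_same_Basis)
      moreover have "x \<bullet> u = 0" using x(1) u by (simp add: grid_def)
      ultimately show ?thesis by (simp add: y_def inner_diff_left)
    qed
    ultimately have "y \<in> span B" using VB unfolding V_def by blast
    then obtain r where r: "y = (\<Sum>b\<in>B. r b *\<^sub>R b)"
      unfolding span_finite[OF finB] by blast
    define x' where "x' = x - (\<Sum>b\<in>B. of_int \<lfloor>r b\<rfloor> *\<^sub>R b)"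
    have "x' \<in> grid I n"
      unfolding x'_def using B(1) by (intro grid_sub grid_sum x(1)) blast
    moreover have "w \<bullet> x' = of_int l"
      by (simp add: x'_def inner_diff_right inner_sum_right x(2) B(2))
    moreover have "x' = (\<Sum>b\<in>B. (r b - of_int \<lfloor>r b\<rfloor>) *\<^sub>R b) + (of_int l / (w \<bullet> u0)) *\<^sub>R u0"
    proof -
      have "x = (\<Sum>b\<in>B. r b *\<^sub>R b) + (of_int l / (w \<bullet> u0)) *\<^sub>R u0"
        using r by (simp add: y_def algebra_simps)
      then show ?thesis by (simp add: x'_def scaleR_diff_left sum_subtractf)
    qed
    moreover have "0 \<le> r b - of_int \<lfloor>r b\<rfloor> \<and> r b - of_int \<lfloor>r b\<rfloor> \<le> 1" for b
      by linarith
    ultimately show "\<exists>x. x \<in> grid I n \<and> w \<bullet> x = of_int l \<and> (\<exists>t. (\<forall>b\<in>B. 0 \<le> t b \<and> t b \<le> 1) \<and>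
          x = (\<Sum>b\<in>B. t b *\<^sub>R b) + (of_int l / (w \<bullet> u0)) *\<^sub>R u0)"
      by (intro exI[of _ x'] conjI exI[of _ "\<lambda>b. r b - of_int \<lfloor>r b\<rfloor>"]) simp_all
  qed
  obtain p where p: "\<And>l. p l \<in> grid I n" "\<And>l. w \<bullet> p l = of_int l"
    "\<And>l. \<exists>t. (\<forall>b\<in>B. 0 \<le> t b \<and> t b \<le> 1) \<and>
          p l = (\<Sum>b\<in>B. t b *\<^sub>R b) + (of_int l / (w \<bullet> u0)) *\<^sub>R u0"
    using choice[OF level] by blast
  \<comment> \<open>Both kinds of range start at 0, so a side of length \<open>s\<close> contributes
    \<open>\<lfloor>s\<rfloor> + 1 \<ge> s\<close> integers.\<close>
  define A where "A = {0..\<lfloor>\<bar>w \<bullet> u0\<bar>\<rfloor>}"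
  define P where "P = PiE B (\<lambda>b. {0..\<lfloor>N b\<rfloor>})"
  define \<phi> where "\<phi> = (\<lambda>(l, c). p l + (\<Sum>b\<in>B. of_int (c b) *\<^sub>R b))"
  have w\<phi>: "w \<bullet> \<phi> (l, c) = of_int l" for l c
    by (simp add: \<phi>_def inner_add_right inner_sum_right p(2) B(2))
  have "\<phi> ` (A \<times> P) \<subseteq> G"
  proof clarify
    fix l c assume l: "l \<in> A" and c: "c \<in> P"
    have "\<phi> (l, c) \<in> grid I n"
      unfolding \<phi>_def prod.case using B(1) by (intro grid_add grid_sum p(1)) blast
    moreover have "\<bar>\<phi> (l, c) \<bullet> u\<bar> \<le> R" if u: "u \<in> I" for u
    proof -
      have uB: "u \<in> Basis" and u0B: "u0 \<in> Basis" using u u0 I by blast+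
      obtain t where t: "\<And>b. b \<in> B \<Longrightarrow> 0 \<le> t b \<and> t b \<le> 1"
        "p l = (\<Sum>b\<in>B. t b *\<^sub>R b) + (of_int l / (w \<bullet> u0)) *\<^sub>R u0" using p(3) by blast
      have "\<phi> (l, c) \<bullet> u =
          (\<Sum>b\<in>B. (t b + of_int (c b)) * (b \<bullet> u)) + (of_int l / (w \<bullet> u0)) * (u0 \<bullet> u)"
        by (simp add: \<phi>_def t(2) inner_add_left inner_sum_left sum.distrib distrib_right)
      then have "\<bar>\<phi> (l, c) \<bullet> u\<bar> \<le>
          \<bar>\<Sum>b\<in>B. (t b + of_int (c b)) * (b \<bullet> u)\<bar> + \<bar>of_int l / (w \<bullet> u0)\<bar> * \<bar>u0 \<bullet> u\<bar>"
        by (metis abs_mult abs_triangle_ineq)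
      also have "\<bar>\<Sum>b\<in>B. (t b + of_int (c b)) * (b \<bullet> u)\<bar> \<le> (\<Sum>b\<in>B. 2 * C)"
      proof (rule order_trans[OF sum_abs], rule sum_mono)
        fix b assume b: "b \<in> B"
        have cb: "0 \<le> c b" "c b \<le> \<lfloor>N b\<rfloor>" using c b by (auto simp: P_def dest!: PiE_mem)
        then have "of_int (c b) \<le> N b" by (simp add: le_floor_iff)
        then have "\<bar>t b + of_int (c b)\<bar> \<le> 2 * N b" using t(1)[OF b] N(1)[OF b] cb(1) by linarith
        moreover have "\<bar>b \<bullet> u\<bar> \<le> norm b" using uB by (rule Basis_le_norm)
        ultimately have "\<bar>(t b + of_int (c b)) * (b \<bullet> u)\<bar> \<le> (2 * N b) * norm b"
          unfolding abs_mult using N(1)[OF b] by (intro mult_mono) simp_all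
        also have "\<dots> \<le> 2 * C" using N(2)[OF b] by simp
        finally show "\<bar>(t b + of_int (c b)) * (b \<bullet> u)\<bar> \<le> 2 * C" .
      qed
      also have "(\<Sum>b\<in>B. 2 * C) \<le> 2 * real m * C"
      proof -
        have "real (card B) \<le> real m" using B(4) by simp
        then have "real (card B) * (2 * C) \<le> real m * (2 * C)" using C by (intro mult_right_mono) simp_all
        then show ?thesis by (simp add: mult_ac)
      qed
      also have "\<bar>of_int l / (w \<bullet> u0)\<bar> * \<bar>u0 \<bullet> u\<bar> \<le> 1 * 1"
      proof (rule mult_mono)
        have "0 \<le> l" "l \<le> \<lfloor>\<bar>w \<bullet> u0\<bar>\<rfloor>" using l by (simp_all add: A_def)
        then have "\<bar>of_int l\<bar> \<le> \<bar>w \<bullet> u0\<bar>" by (simp add: le_floor_iff)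
        then show "\<bar>of_int l / (w \<bullet> u0)\<bar> \<le> 1" using u0(2) by (simp add: abs_divide divide_le_eq)
        show "\<bar>u0 \<bullet> u\<bar> \<le> 1" using uB u0B by (simp add: inner_Basis)
      qed simp_all
      finally show ?thesis by (simp add: R_def)
    qed
    ultimately show "\<phi> (l, c) \<in> G" by (simp add: G_def)
  qed
  \<comment> \<open>\<open>w\<close> reads off the level \<open>l\<close>, and independence of
    \<open>B\<close> determines the remaining coefficients.\<close>
  moreover have inj: "inj_on \<phi> (A \<times> P)"
  proof (rule inj_onI, clarify)
    fix l c l' c' assume h: "c \<in> P" "c' \<in> P" "\<phi> (l, c) = \<phi> (l', c')"
    have ll: "l = l'" using w\<phi>[of l c] w\<phi>[of l' c'] h(3) by simp
    have "(\<Sum>b\<in>B. of_int (c b) *\<^sub>R b) = (\<Sum>b\<in>B. of_int (c' b) *\<^sub>R b)"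
      using h(3) ll by (simp add: \<phi>_def)
    then have "(\<Sum>b\<in>B. of_int (c b - c' b) *\<^sub>R b) = 0"
      by (simp add: scaleR_diff_left sum_subtractf)
    then have "real_of_int (c b - c' b) = 0" if "b \<in> B" for b
      using independentD[OF B(3) finB subset_refl, of "\<lambda>b. of_int (c b - c' b)"] that by blast
    then have "c b = c' b" if "b \<in> B" for b using that by force
    then have "c = c'" using h(1,2) unfolding P_def by (intro PiE_ext)
    then show "l = l' \<and> c = c'" using ll by simp
  qed
  ultimately have "card (A \<times> P) \<le> card G" using finG by (intro card_inj_on_le[of \<phi>])
  then have "real (card A * card P) \<le> real (card G)" by (simp only: card_cartesian_product of_nat_le_iff)
  moreover have "\<bar>w \<bullet> u0\<bar> * (\<Prod>b\<in>B. N b) \<le> real (card A * card P)"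
  proof -
    have "(\<Prod>b\<in>B. N b) \<le> (\<Prod>b\<in>B. real (card {0..\<lfloor>N b\<rfloor>}))"
    proof (intro prod_mono conjI)
      fix b assume b: "b \<in> B"
      show "0 \<le> N b" using N(1)[OF b] by simp
      then have "0 \<le> \<lfloor>N b\<rfloor>" by simp
      then show "N b \<le> real (card {0..\<lfloor>N b\<rfloor>})" by simp
    qed
    also have "\<dots> = real (card P)" unfolding P_def using finB by (simp add: card_PiE)
    finally have 1: "(\<Prod>b\<in>B. N b) \<le> real (card P)" .
    have "0 \<le> \<lfloor>\<bar>w \<bullet> u0\<bar>\<rfloor>" by simp
    then have 2: "\<bar>w \<bullet> u0\<bar> \<le> real (card A)" by (simp add: A_def)
    have "0 \<le> (\<Prod>b\<in>B. N b)" using N(1) by (intro prod_nonneg) force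
    then show ?thesis using 1 2 by (simp add: mult_mono)
  qed
  ultimately show ?thesis using cardG unfolding R_def by linarith
qed

text \<open>A nonzero vector has a nonzero coordinate \<open>v\<close>, which admits at most
  \<open>2 * r / n v\<close> values, with no additive 1 because 0 is excluded; this makes the bound
  linear in \<open>r\<close>. Every other coordinate admits at most \<open>3 * T / n u\<close>
  values because \<open>n u \<le> T\<close>. The factor \<open>m\<close> accounts for the choice of
  \<open>v\<close>.\<close>

lemma grid_small_points:
  fixes n :: "'a::euclidean_space \<Rightarrow> real"
  assumes I: "I \<subseteq> Basis" and m: "card I = m" and n: "\<And>u. u \<in> I \<Longrightarrow> n u > 0" "\<And>u. u \<in> I \<Longrightarrow> n u \<le> T"
    and r: "0 \<le> r" "r \<le> T"
  shows "finite {w \<in> grid I (\<lambda>u. 1 / n u). w \<noteq> 0 \<and> (\<forall>u\<in>I. \<bar>w \<bullet> u\<bar> \<le> r)}"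
    and "real (card {w \<in> grid I (\<lambda>u. 1 / n u). w \<noteq> 0 \<and> (\<forall>u\<in>I. \<bar>w \<bullet> u\<bar> \<le> r)})
      \<le> real m * 3 ^ m * T ^ (m - 1) / (\<Prod>u\<in>I. n u) * r"
proof -
  define E where "E = {w \<in> grid I (\<lambda>u. 1 / n u). w \<noteq> 0 \<and> (\<forall>u\<in>I. \<bar>w \<bullet> u\<bar> \<le> r)}"
  have fin: "finite I" using I finite_subset[OF _ finite_Basis] by blast
  have n': "\<And>u. u \<in> I \<Longrightarrow> 1 / n u > 0" using n by simp
  define z where "z u = \<lfloor>r / n u\<rfloor>" for u
  define A where "A v u = (if u = v then {-z u..z u} - {0} else {-z u..z u})" for u v
  define W where "W v = {w \<in> grid I (\<lambda>u. 1 / n u). \<forall>u\<in>I. \<lfloor>1 / n u * (w \<bullet> u)\<rfloor> \<in> A v u}" for v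
  have fA: "finite (A v u)" for u v by (simp add: A_def)
  have finW: "finite (W v)" for v unfolding W_def by (rule grid_window(1)[OF I n' fA])
  have sub: "E \<subseteq> (\<Union>v\<in>I. W v)"
  proof
    fix w assume w: "w \<in> E"
    then have wg: "w \<in> grid I (\<lambda>u. 1 / n u)" and w0: "w \<noteq> 0" and wr: "\<And>u. u \<in> I \<Longrightarrow> \<bar>w \<bullet> u\<bar> \<le> r"
      by (simp_all add: E_def)
    obtain v where v: "v \<in> I" "w \<bullet> v \<noteq> 0"
    proof -
      have "\<exists>u\<in>I. w \<bullet> u \<noteq> 0"
      proof (rule ccontr)
        assume "\<not> (\<exists>u\<in>I. w \<bullet> u \<noteq> 0)"
        then have "(\<Sum>u\<in>I. (w \<bullet> u) *\<^sub>R u) = 0" by simp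
        then show False using grid_eq_sum[OF I wg] w0 by simp
      qed
      then show ?thesis using that by blast
    qed
    have "\<lfloor>1 / n u * (w \<bullet> u)\<rfloor> \<in> A v u" if u: "u \<in> I" for u
    proof -
      have int: "1 / n u * (w \<bullet> u) \<in> \<int>" using wg u by (simp add: grid_def)
      have "\<bar>1 / n u * (w \<bullet> u)\<bar> = \<bar>w \<bullet> u\<bar> / n u" using n(1)[OF u] by (simp add: abs_mult)
      also have "\<dots> \<le> r / n u" using wr[OF u] n(1)[OF u] by (intro divide_right_mono) simp_all
      finally have 1: "\<lfloor>1 / n u * (w \<bullet> u)\<rfloor> \<in> {-z u..z u}"
        unfolding z_def using abs_le_iff_floor_window[OF int] by blast
      show ?thesis
      proof (cases "u = v")
        case True
        have "of_int \<lfloor>1 / n u * (w \<bullet> u)\<rfloor> = 1 / n u * (w \<bullet> u)" using int by (rule of_int_floor)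
        moreover have "1 / n u * (w \<bullet> u) \<noteq> 0" using v(2) n(1)[OF u] True by simp
        ultimately have "\<lfloor>1 / n u * (w \<bullet> u)\<rfloor> \<noteq> 0" by (metis of_int_0)
        then show ?thesis using 1 True unfolding A_def by simp
      next
        case False
        then show ?thesis using 1 unfolding A_def by simp
      qed
    qed
    then have "w \<in> W v" using wg by (simp add: W_def)
    then show "w \<in> (\<Union>v\<in>I. W v)" using v(1) by blast
  qed
  have finU: "finite (\<Union>v\<in>I. W v)" using fin finW by blast
  then show "finite {w \<in> grid I (\<lambda>u. 1 / n u). w \<noteq> 0 \<and> (\<forall>u\<in>I. \<bar>w \<bullet> u\<bar> \<le> r)}"
    using sub finite_subset unfolding E_def by blast
  have prod0: "(\<Prod>u\<in>I. n u) > 0" using n(1) by (intro prod_pos) blast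
  have cardW: "real (card (W v)) \<le> 3 ^ m * T ^ (m - 1) / (\<Prod>u\<in>I. n u) * r" if v: "v \<in> I" for v
  proof -
    have "real (card (W v)) = (\<Prod>u\<in>I. real (card (A v u)))"
      unfolding W_def by (subst grid_window(2)[OF I n' fA]) simp_all
    also have "\<dots> = real (card (A v v)) * (\<Prod>u\<in>I - {v}. real (card (A v u)))"
      using fin v by (rule prod.remove)
    also have "\<dots> \<le> (3 * r / n v) * (\<Prod>u\<in>I - {v}. 3 * T / n u)"
    proof (rule mult_mono)
      have z0: "0 \<le> z u" if "u \<in> I" for u using r(1) n(1)[OF that] by (simp add: z_def)
      have "A v v = {-z v..z v} - {0}" by (simp add: A_def)
      then have "card (A v v) = nat (2 * z v)" using z0[OF v] by (simp add: nat_diff_distrib)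
      then have "real (card (A v v)) = 2 * of_int (z v)" using z0[OF v] by simp
      also have "\<dots> \<le> 2 * (r / n v)" unfolding z_def using of_int_floor_le by (intro mult_left_mono) simp_all
      also have "\<dots> \<le> 3 * r / n v" using r(1) n(1)[OF v] by (simp add: divide_right_mono)
      finally show "real (card (A v v)) \<le> 3 * r / n v" .
      show "(\<Prod>u\<in>I - {v}. real (card (A v u))) \<le> (\<Prod>u\<in>I - {v}. 3 * T / n u)"
      proof (intro prod_mono conjI)
        fix u assume u: "u \<in> I - {v}"
        then have uI: "u \<in> I" by blast
        have "real (card (A v u)) \<le> 2 * (r / n u) + 1"
          using real_card_floor_window[of "r / n u"] r(1) n(1)[OF uI] u by (simp add: A_def z_def)
        also have "\<dots> \<le> 2 * (T / n u) + T / n u"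
          using r(2) n[OF uI] by (intro add_mono mult_left_mono divide_right_mono) simp_all
        finally show "real (card (A v u)) \<le> 3 * T / n u" by simp
      qed simp
      show "0 \<le> 3 * r / n v" using r(1) n(1)[OF v] by simp
    qed (simp add: prod_nonneg)
    also have "(\<Prod>u\<in>I - {v}. 3 * T / n u) = (3 * T) ^ (m - 1) / (\<Prod>u\<in>I - {v}. n u)"
      using fin v m by (simp add: prod_dividef)
    also have "(3 * r / n v) * ((3 * T) ^ (m - 1) / (\<Prod>u\<in>I - {v}. n u)) =
        3 * 3 ^ (m - 1) * T ^ (m - 1) * r / (n v * (\<Prod>u\<in>I - {v}. n u))"
      by (simp add: power_mult_distrib)
    also have "n v * (\<Prod>u\<in>I - {v}. n u) = (\<Prod>u\<in>I. n u)" using fin v by (simp add: prod.remove)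
    also have "3 * 3 ^ (m - 1) = (3::real) ^ m"
      using m v fin by (metis Suc_diff_1 card_gt_0_iff empty_iff power_Suc)
    finally show ?thesis by simp
  qed
  have "card E \<le> card (\<Union>v\<in>I. W v)" using finU sub by (rule card_mono)
  also have "\<dots> \<le> (\<Sum>v\<in>I. card (W v))" using fin by (rule card_UN_le)
  finally have "real (card E) \<le> (\<Sum>v\<in>I. real (card (W v)))" by (metis of_nat_le_iff of_nat_sum)
  also have "\<dots> \<le> (\<Sum>v\<in>I. 3 ^ m * T ^ (m - 1) / (\<Prod>u\<in>I. n u) * r)"
    using cardW by (rule sum_mono)
  also have "\<dots> = real m * 3 ^ m * T ^ (m - 1) / (\<Prod>u\<in>I. n u) * r" using m by simp
  finally show "real (card {w \<in> grid I (\<lambda>u. 1 / n u). w \<noteq> 0 \<and> (\<forall>u\<in>I. \<bar>w \<bullet> u\<bar> \<le> r)})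
      \<le> real m * 3 ^ m * T ^ (m - 1) / (\<Prod>u\<in>I. n u) * r" by (simp add: E_def)
qed

subsection \<open>Hyperplane sections of a box\<close>

text \<open>Index sets are taken in \<open>Basis\<close> because a definition cannot quantify over
  index types; \<open>box_cover_boundD\<close> transfers the bound to other finite index sets. The
  exponent turns the product \<open>P\<close> of the sides into \<open>\<alpha> ^ (m - k)\<close>
  for \<open>\<alpha> = P powr (1 / (m - 1))\<close>.\<close>

definition box_cover_bound :: "'a::euclidean_space itself \<Rightarrow> nat \<Rightarrow> nat \<Rightarrow> real \<Rightarrow> bool" where
  "box_cover_bound TYPE('a) m k C \<longleftrightarrow>
     (\<forall>I (F :: 'a \<Rightarrow> 'a) n. I \<subseteq> Basis \<and> card I = m \<and> (\<forall>u\<in>I. 1 \<le> n u) \<longrightarrow>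
        coverable (lattice_box I F n) k (C * (\<Prod>u\<in>I. n u) powr (real (m - k) / real (m - 1))))"

lemma box_cover_boundD:
  fixes F :: "'i \<Rightarrow> 'a::euclidean_space"
  assumes bound: "box_cover_bound TYPE('a) m k C"
    and J: "finite J" "card J = m" "m \<le> DIM('a)" and n: "\<And>j. j \<in> J \<Longrightarrow> 1 \<le> n j"
  shows "coverable (lattice_box J F n) k (C * (\<Prod>j\<in>J. n j) powr (real (m - k) / real (m - 1)))"
proof -
  obtain I :: "'a set" where I: "I \<subseteq> Basis" "card I = m" "finite I"
    using obtain_subset_with_card_n[OF J(3)] by blast
  obtain h where h: "bij_betw h I J"
    using finite_same_card_bij[OF I(3) J(1)] I(2) J(2) by auto
  have eq: "lattice_box J F n = lattice_box I (F \<circ> h) (n \<circ> h)" using h by (rule lattice_box_reindex)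
  have p: "(\<Prod>u\<in>I. (n \<circ> h) u) = (\<Prod>j\<in>J. n j)"
    using prod.reindex_bij_betw[OF h, of n] by simp
  have "\<forall>u\<in>I. 1 \<le> (n \<circ> h) u" using n bij_betwE[OF h] by simp
  then have "coverable (lattice_box I (F \<circ> h) (n \<circ> h)) k
      (C * (\<Prod>u\<in>I. (n \<circ> h) u) powr (real (m - k) / real (m - 1)))"
    using bound I(1,2) unfolding box_cover_bound_def by blast
  then show ?thesis unfolding eq p .
qed

lemma lattice_box_subset_grid:
  assumes I: "I \<subseteq> Basis" and n: "\<And>u. u \<in> I \<Longrightarrow> n u > 0"
  shows "lattice_box I (\<lambda>u. (1 / n u) *\<^sub>R u) n \<subseteq> {x \<in> grid I n. \<forall>u\<in>I. \<bar>x \<bullet> u\<bar> \<le> 1}"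
proof
  fix x assume "x \<in> lattice_box I (\<lambda>u. (1 / n u) *\<^sub>R u) n"
  then obtain c where c: "x = (\<Sum>u\<in>I. of_int (c u) *\<^sub>R (1 / n u) *\<^sub>R u)" "\<And>u. u \<in> I \<Longrightarrow> \<bar>real_of_int (c u)\<bar> \<le> n u"
    unfolding lattice_box_def by blast
  have x: "x = (\<Sum>u\<in>I. (of_int (c u) / n u) *\<^sub>R u)" by (simp add: c(1))
  have xu: "x \<bullet> u = (if u \<in> I then of_int (c u) / n u else 0)" if "u \<in> Basis" for u
    unfolding x by (rule inner_sum_Basis[OF I that])
  have "n u * (x \<bullet> u) = of_int (c u)" "\<bar>x \<bullet> u\<bar> \<le> 1" if u: "u \<in> I" for u
  proof -
    have "u \<in> Basis" using u I by blast
    then have "x \<bullet> u = of_int (c u) / n u" using xu u by simp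
    then show "n u * (x \<bullet> u) = of_int (c u)" "\<bar>x \<bullet> u\<bar> \<le> 1"
      using n[OF u] c(2)[OF u] by simp_all
  qed
  moreover have "x \<bullet> u = 0" if "u \<in> Basis - I" for u using xu that by simp
  ultimately show "x \<in> {x \<in> grid I n. \<forall>u\<in>I. \<bar>x \<bullet> u\<bar> \<le> 1}" by (simp add: grid_def)
qed

text \<open>Reduces arbitrary families to the scaled standard basis, where the box lies in the unit
  cube of a grid and inner products with dual vectors make sense.\<close>

lemma lattice_box_eq_linear_image:
  fixes F :: "'a::euclidean_space \<Rightarrow> 'a"
  assumes I: "I \<subseteq> Basis" and n: "\<And>u. u \<in> I \<Longrightarrow> n u > 0"
  shows "\<exists>g. linear g \<and> lattice_box I F n = g ` lattice_box I (\<lambda>u. (1 / n u) *\<^sub>R u) n"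
proof -
  define g where "g x = (\<Sum>v\<in>I. (n v * (x \<bullet> v)) *\<^sub>R F v)" for x
  have lin: "linear g"
    unfolding g_def
    by (intro linearI) (simp_all add: inner_add_left distrib_left scaleR_add_left sum.distrib
          scaleR_sum_right mult_ac)
  have fin: "finite I" using I finite_subset[OF _ finite_Basis] by blast
  have "g ((1 / n u) *\<^sub>R u) = F u" if u: "u \<in> I" for u
  proof -
    have "g ((1 / n u) *\<^sub>R u) = (\<Sum>v\<in>I. if v = u then F v else 0)"
      unfolding g_def
    proof (rule sum.cong[OF refl])
      fix v assume v: "v \<in> I"
      have "u \<in> Basis" "v \<in> Basis" using u v I by blast+
      then show "(n v * ((1 / n u) *\<^sub>R u \<bullet> v)) *\<^sub>R F v = (if v = u then F v else 0)"
        using n[OF u] by (cases "v = u") (simp_all add: inner_Basis)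
    qed
    then show ?thesis using fin u by simp
  qed
  then have "lattice_box I (g \<circ> (\<lambda>u. (1 / n u) *\<^sub>R u)) n = lattice_box I F n"
    unfolding lattice_box_def by simp
  then show ?thesis using lattice_box_linear_image[OF lin] lin by metis
qed

lemma powr_quotient_of_power:
  assumes "\<alpha> > 0" "a > 0"
  shows "(\<alpha> ^ a) powr (real b / real a) = \<alpha> ^ b"
proof -
  have "(\<alpha> ^ a) powr (real b / real a) = (\<alpha> powr real a) powr (real b / real a)"
    using assms(1) by (simp add: powr_realpow)
  also have "\<dots> = \<alpha> powr real b" using assms(2) by (simp add: powr_powr)
  finally show ?thesis using assms(1) by (simp add: powr_realpow)
qed

lemma powr_le_self:
  fixes K b :: real
  assumes "K \<ge> 1" "0 \<le> b" "b \<le> 1"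
  shows "K powr b \<le> K"
proof -
  have "K powr b \<le> K powr 1" using assms by (intro powr_mono) auto
  then show ?thesis using assms by simp
qed

lemma grid_scaled_basis:
  fixes n :: "'a::euclidean_space \<Rightarrow> real"
  assumes I: "I \<subseteq> Basis" and n: "\<And>u. u \<in> I \<Longrightarrow> n u > 0"
  shows "inj_on (\<lambda>u. (1 / n u) *\<^sub>R u) I" and "independent ((\<lambda>u. (1 / n u) *\<^sub>R u) ` I)"
proof -
  have orth: "u \<bullet> v = 0" if "u \<in> I" "v \<in> I" "u \<noteq> v" for u v
    using that I by (intro inner_not_same_Basis) blast+
  have self: "u \<bullet> u = 1" if "u \<in> I" for u using that I by (simp add: inner_same_Basis subset_eq)
  show inj: "inj_on (\<lambda>u. (1 / n u) *\<^sub>R u) I"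
  proof (rule inj_onI, rule ccontr)
    fix u v assume uv: "u \<in> I" "v \<in> I" "(1 / n u) *\<^sub>R u = (1 / n v) *\<^sub>R v" "u \<noteq> v"
    have "((1 / n u) *\<^sub>R u) \<bullet> u = ((1 / n v) *\<^sub>R v) \<bullet> u" using uv(3) by simp
    then have "1 / n u = 0" using orth[OF uv(2,1)] self[OF uv(1)] uv(4) by auto
    then show False using n[OF uv(1)] by simp
  qed
  show "independent ((\<lambda>u. (1 / n u) *\<^sub>R u) ` I)"
  proof (rule pairwise_orthogonal_independent)
    show "pairwise orthogonal ((\<lambda>u. (1 / n u) *\<^sub>R u) ` I)"
      using orth by (auto simp: pairwise_def orthogonal_def)
    show "0 \<notin> (\<lambda>u. (1 / n u) *\<^sub>R u) ` I"
    proof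
      assume "0 \<in> (\<lambda>u. (1 / n u) *\<^sub>R u) ` I"
      then obtain u where u: "u \<in> I" "(1 / n u) *\<^sub>R u = 0" by auto
      then have "u = 0" using n[OF u(1)] by simp
      then show False using self[OF u(1)] by simp
    qed
  qed
qed

text \<open>If the section spans the hyperplane, the grid
  inside it has a reduced basis and the packing lemma bounds the resulting box; otherwise two
  coordinates can be dropped.\<close>

lemma coverable_hyperplane_section:
  fixes n :: "'a::euclidean_space \<Rightarrow> real"
  assumes I: "I \<subseteq> Basis" "card I = m" and n: "\<And>u. u \<in> I \<Longrightarrow> 1 \<le> n u" "\<And>u. u \<in> I \<Longrightarrow> n u \<le> \<alpha>"
    and \<alpha>: "\<alpha> ^ (m - 1) = (\<Prod>u\<in>I. n u)"
    and k: "2 \<le> k" "k < m"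
    and Ca: "k \<le> m - 2 \<Longrightarrow> box_cover_bound TYPE('a) (m - 2) k Ca" "Ca \<ge> 1"
    and Cb: "box_cover_bound TYPE('a) (m - 1) k Cb" "Cb \<ge> 1"
    and R: "\<And>L::'a set. discrete_subgroup L \<Longrightarrow> dim L = m - 1 \<Longrightarrow>
     (\<exists>B\<subseteq>L. finite B \<and> card B = m - 1 \<and> independent B \<and>
        (\<forall>x\<in>L. \<exists>c::'a \<Rightarrow> int. x = (\<Sum>b\<in>B. of_int (c b) *\<^sub>R b) \<and>
           (\<forall>b\<in>B. \<bar>of_int (c b)\<bar> * norm b \<le> Cr * norm x)))" and Cr: "Cr \<ge> 1"
    and w: "primitive (grid I (\<lambda>u. 1 / n u)) w"
    and K: "K \<ge> 1" "infnorm w \<le> K * \<alpha>"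
  shows "coverable {x \<in> lattice_box I (\<lambda>u. (1 / n u) *\<^sub>R u) n. w \<bullet> x = 0} k
     ((Ca * K + Cb * (3 * (1 + 2 * real m * (Cr * real m))) ^ m) *
       (\<alpha> ^ (m - 1) / infnorm w) powr (real (m - 1 - k) / real (m - 2)))"
proof -
  define \<beta> where "\<beta> = real (m - 1 - k) / real (m - 2)"
  have \<beta>: "0 \<le> \<beta>" "\<beta> \<le> 1" using k by (simp_all add: \<beta>_def divide_le_eq_1)
  have fin: "finite I" using I(1) finite_subset[OF _ finite_Basis] by blast
  have n0: "\<And>u. u \<in> I \<Longrightarrow> n u > 0" using n(1) by force
  have "I \<noteq> {}" using I(2) k by auto
  then have \<alpha>1: "\<alpha> \<ge> 1" using n by force
  have wg: "w \<in> grid I (\<lambda>u. 1 / n u)" and w0: "w \<noteq> 0"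
    using w unfolding primitive_def by blast+
  have iw: "infnorm w > 0" using w0 by (simp add: infnorm_pos_lt)
  \<comment> \<open>Up to the constant \<open>E\<close>, this bounds the product of the sides of a
    spanning section.\<close>
  define q where "q = \<alpha> ^ (m - 1) / infnorm w"
  have q0: "q > 0" using \<alpha>1 iw by (simp add: q_def)
  define E where "E = (3 * (1 + 2 * real m * (Cr * real m))) ^ m"
  have E: "E \<ge> 1" unfolding E_def using Cr by (intro one_le_power) (simp add: add_increasing2)
  define X where "X = {x \<in> lattice_box I (\<lambda>u. (1 / n u) *\<^sub>R u) n. w \<bullet> x = 0}"
  have Xgrid: "x \<in> grid I n" "\<And>u. u \<in> I \<Longrightarrow> \<bar>x \<bullet> u\<bar> \<le> 1" "w \<bullet> x = 0" if "x \<in> X" for x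
    using that lattice_box_subset_grid[where n = n, OF I(1) n0] unfolding X_def by blast+
  define V where "V = {v. (\<forall>u\<in>Basis - I. v \<bullet> u = 0) \<and> w \<bullet> v = 0}"
  have dimV: "dim V < m"
    unfolding V_def I(2)[symmetric] using I(1) w0 wg by (intro dim_hyperplane_coordinate_le) (simp_all add: grid_def)
  have XV: "X \<subseteq> V" using Xgrid unfolding V_def grid_def by blast
  \<comment> \<open>For degenerate sections, where the product of the remaining sides is bounded by
    \<open>\<alpha> ^ (m - 2)\<close> only; the size bound on \<open>w\<close> lets
    \<open>K * q\<close> dominate it.\<close>
  have q_low: "\<alpha> ^ (m - 2) \<le> K * q"
  proof -
    have "m - 1 = Suc (m - 2)" using k by simp
    then have "\<alpha> ^ (m - 1) = \<alpha> ^ (m - 2) * \<alpha>" by simp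
    then have "K * \<alpha> ^ (m - 1) = \<alpha> ^ (m - 2) * (K * \<alpha>)" by simp
    moreover have "\<alpha> ^ (m - 2) * infnorm w \<le> \<alpha> ^ (m - 2) * (K * \<alpha>)"
      using K(2) \<alpha>1 by (intro mult_left_mono) simp_all
    ultimately have "\<alpha> ^ (m - 2) * infnorm w \<le> K * \<alpha> ^ (m - 1)" by (simp only:)
    then show ?thesis using iw by (simp add: q_def pos_le_divide_eq)
  qed
  have Kq: "(K * q) powr \<beta> \<le> K * q powr \<beta>"
  proof -
    have "(K * q) powr \<beta> = K powr \<beta> * q powr \<beta>" using K q0 by (simp add: powr_mult)
    then show ?thesis using powr_le_self[OF K(1) \<beta>] by (simp add: mult_right_mono)
  qed
  have qp: "q powr \<beta> \<ge> 0" by simp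
  have "coverable X k ((Ca * K + Cb * E) * q powr \<beta>)"
  proof (cases "dim X + 2 \<le> m")
    case True
    have "coverable X k (Ca * K * q powr \<beta>)"
    proof (cases "k \<le> m - 2")
      case False
      \<comment> \<open>Here the exponent is 0 and one subspace has to suffice; the span of a
        degenerate section is small enough.\<close>
      then have "k = m - 1" using k by simp
      then have "\<beta> = 0" by (simp add: \<beta>_def)
      moreover have "1 * 1 \<le> Ca * K" using Ca(2) K(1) by (intro mult_mono) simp_all
      ultimately show ?thesis using True \<open>k = m - 1\<close> q0 by (intro coverable_single) simp_all
    next
      case True': True
      have m4: "m \<ge> 4" using True' k(1) by simp
      obtain i j F' where ij: "i \<in> I" "j \<in> I - {i}"
        and XF: "X \<subseteq> lattice_box (I - {i, j}) (F' :: 'a \<Rightarrow> 'a) n"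
        using lattice_box_drop_two[OF fin grid_scaled_basis[where n = n, OF I(1) n0], of X n] True I(2)
        unfolding X_def by blast
      define J where "J = I - {i, j}"
      have cJ: "card J = m - 2"
      proof -
        have "card {i, j} = 2" using ij(2) by auto
        then show ?thesis unfolding J_def using ij I(2) by (subst card_Diff_subset) auto
      qed
      have nJ: "1 \<le> n u" "n u \<le> \<alpha>" if "u \<in> J" for u using that n by (simp_all add: J_def)
      have "coverable (lattice_box J F' n) k (Ca * (\<Prod>u\<in>J. n u) powr (real (m - 2 - k) / real (m - 2 - 1)))"
        using Ca(1)[OF True'] I(1) cJ nJ unfolding box_cover_bound_def J_def by blast
      moreover have "(\<Prod>u\<in>J. n u) powr (real (m - 2 - k) / real (m - 2 - 1)) \<le> K * q powr \<beta>"
      proof -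
        have "(\<Prod>u\<in>J. n u) \<le> (\<Prod>u\<in>J. \<alpha>)"
          using nJ by (intro prod_mono) force
        then have p: "(\<Prod>u\<in>J. n u) \<le> \<alpha> ^ (m - 2)" using cJ by simp
        have "1 \<le> (\<Prod>u\<in>J. n u)" using nJ by (intro prod_ge_1)
        then have "(\<Prod>u\<in>J. n u) powr (real (m - 2 - k) / real (m - 2 - 1))
            \<le> (\<alpha> ^ (m - 2)) powr (real (m - 2 - k) / real (m - 2 - 1))"
          using p by (intro powr_mono2) simp_all
        \<comment> \<open>Losing one more dimension does not raise the exponent:
          \<open>a / (k' + a) \<le> (a + 1) / (k' + a + 1)\<close> with \<open>a = m - 2 - k\<close>
          and \<open>k' = k - 1\<close>.\<close>
        also have "\<dots> \<le> (\<alpha> ^ (m - 2)) powr \<beta>"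
        proof (rule powr_mono)
          have "k + 2 \<le> m" using True' m4 by linarith
          then obtain a where a: "m = k + 2 + a" using le_Suc_ex by blast
          obtain k' where k': "k = Suc k'" "k' > 0" using k(1) by (cases k) simp_all
          have "real a * (real k' + real a + 1) \<le> (real a + 1) * (real k' + real a)"
            by (simp add: algebra_simps)
          then have "real a / (real k' + real a) \<le> (real a + 1) / (real k' + real a + 1)"
            using k'(2) by (simp add: frac_le_eq divide_le_0_iff)
          then show "real (m - 2 - k) / real (m - 2 - 1) \<le> \<beta>"
            by (simp add: \<beta>_def a k'(1) add_ac)
          show "1 \<le> \<alpha> ^ (m - 2)" using \<alpha>1 by simp
        qed
        also have "\<dots> \<le> (K * q) powr \<beta>" using q_low \<beta> \<alpha>1 by (intro powr_mono2) simp_all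
        finally show ?thesis using Kq by linarith
      qed
      then have "Ca * (\<Prod>u\<in>J. n u) powr (real (m - 2 - k) / real (m - 2 - 1)) \<le> Ca * (K * q powr \<beta>)"
        using Ca(2) by (intro mult_left_mono) simp_all
      ultimately show ?thesis using XF unfolding J_def mult.assoc by (meson coverable_mono order_refl)
    qed
    moreover have "Ca * K * q powr \<beta> \<le> (Ca * K + Cb * E) * q powr \<beta>"
      using Cb(2) E qp by (intro mult_right_mono) simp_all
    ultimately show ?thesis by (meson coverable_mono order_refl)
  next
    case False
    define L where "L = {x \<in> grid I n. w \<bullet> x = 0}"
    have dsL: "discrete_subgroup L"
      unfolding discrete_subgroup_def
    proof (intro conjI ballI allI)
      fix r
      have "L \<inter> cball 0 r \<subseteq> grid I n \<inter> cball 0 r" unfolding L_def by blast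
      moreover have "finite (grid I n \<inter> cball 0 r)"
        using discrete_subgroup_grid[where n = n, OF I(1) n0] unfolding discrete_subgroup_def by blast
      ultimately show "finite (L \<inter> cball 0 r)" by (rule finite_subset)
    qed (simp_all add: L_def grid_zero grid_sub inner_diff_right)
    have "X \<subseteq> L" using Xgrid unfolding L_def by blast
    have LV: "L \<subseteq> V" unfolding L_def V_def grid_def by blast
    have dimL: "dim L = m - 1"
      using dim_subset[OF \<open>X \<subseteq> L\<close>] dim_subset[OF LV] False dimV by linarith
    obtain B where B: "B \<subseteq> L" "finite B" "card B = m - 1" "independent B"
      and Bc: "\<And>x. x \<in> L \<Longrightarrow> \<exists>c::'a \<Rightarrow> int. x = (\<Sum>b\<in>B. of_int (c b) *\<^sub>R b) \<and>
           (\<forall>b\<in>B. \<bar>of_int (c b)\<bar> * norm b \<le> Cr * norm x)"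
      using R[OF dsL dimL] by blast
    have "0 \<notin> B" using B(4) dependent_zero by blast
    then have b0: "norm b > 0" if "b \<in> B" for b using that by (cases "b = 0") simp_all
    \<comment> \<open>Points of \<open>X\<close> lie in the cube, so their norm is at most their l1
      norm, hence at most \<open>m\<close>.\<close>
    define N where "N b = Cr * real m / norm b" for b :: 'a
    have coeff: "\<exists>c::'a \<Rightarrow> int. x = (\<Sum>b\<in>B. of_int (c b) *\<^sub>R b) \<and> (\<forall>b\<in>B. \<bar>of_int (c b)\<bar> \<le> N b)"
      if x: "x \<in> X" for x
    proof -
      have xL: "x \<in> L" using x \<open>X \<subseteq> L\<close> by blast
      have "norm x \<le> (\<Sum>u\<in>Basis. \<bar>x \<bullet> u\<bar>)" by (rule norm_le_l1)
      also have "\<dots> = (\<Sum>u\<in>I. \<bar>x \<bullet> u\<bar>)"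
        using Xgrid(1)[OF x] I(1) by (intro sum.mono_neutral_right) (simp_all add: grid_def)
      also have "\<dots> \<le> (\<Sum>u\<in>I. 1)" using Xgrid(2)[OF x] by (rule sum_mono)
      finally have nx: "norm x \<le> real m" using I(2) by simp
      obtain c :: "'a \<Rightarrow> int" where c: "x = (\<Sum>b\<in>B. of_int (c b) *\<^sub>R b)"
         "\<And>b. b \<in> B \<Longrightarrow> \<bar>of_int (c b)\<bar> * norm b \<le> Cr * norm x" using Bc[OF xL] by blast
      have "\<bar>of_int (c b)\<bar> \<le> N b" if b: "b \<in> B" for b
      proof -
        have "Cr * norm x \<le> Cr * real m" using nx Cr by (intro mult_left_mono) simp_all
        then have "\<bar>of_int (c b)\<bar> * norm b \<le> Cr * real m" using c(2)[OF b] by linarith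
        then show ?thesis using b0[OF b] by (simp add: N_def pos_le_divide_eq)
      qed
      then show ?thesis using c(1) by blast
    qed
    then have Xbox: "X \<subseteq> lattice_box B (\<lambda>b. b) N" unfolding lattice_box_def by blast
    \<comment> \<open>If \<open>N b < 1\<close>, the integer coefficient at \<open>b\<close>
      vanishes on all of \<open>X\<close>, which then has dimension at most \<open>m - 2\<close>,
      contrary to the case.\<close>
    have N1: "1 \<le> N b" if b: "b \<in> B" for b
    proof (rule ccontr)
      assume "\<not> 1 \<le> N b"
      have "X \<subseteq> span (B - {b})"
      proof
        fix x assume "x \<in> X"
        then obtain c :: "'a \<Rightarrow> int" where c: "x = (\<Sum>b\<in>B. of_int (c b) *\<^sub>R b)"
          "\<And>b. b \<in> B \<Longrightarrow> \<bar>of_int (c b)\<bar> \<le> N b" using coeff by blast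
        have "\<bar>real_of_int (c b)\<bar> < 1" using c(2)[OF b] \<open>\<not> 1 \<le> N b\<close> by linarith
        then have "c b = 0" by linarith
        then have "x = (\<Sum>b\<in>B - {b}. of_int (c b) *\<^sub>R b)"
          using c(1) B(2) b by (simp add: sum.remove)
        moreover have "(\<Sum>b\<in>B - {b}. of_int (c b) *\<^sub>R b) \<in> span (B - {b})"
          by (intro span_sum span_scale span_base)
        ultimately show "x \<in> span (B - {b})" by simp
      qed
      then have "dim X \<le> card (B - {b})" using B(2) by (intro dim_le_card) simp_all
      then show False using False B(2,3) b k by simp
    qed
    \<comment> \<open>A coordinate attaining the sup norm gives the largest gain in the packing
      bound.\<close>
    obtain u0 where u0: "u0 \<in> Basis" "infnorm w = \<bar>w \<bullet> u0\<bar>"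
    proof -
      have "Max ((\<lambda>i. \<bar>w \<bullet> i\<bar>) ` Basis) \<in> (\<lambda>i. \<bar>w \<bullet> i\<bar>) ` Basis" by (intro Max_in) simp_all
      then show ?thesis using that unfolding infnorm_Max by blast
    qed
    have "w \<bullet> u0 \<noteq> 0" using iw u0(2) by auto
    then have u0I: "u0 \<in> I" using wg u0(1) unfolding grid_def by blast
    have "\<bar>w \<bullet> u0\<bar> * (\<Prod>b\<in>B. N b) \<le> E * (\<Prod>u\<in>I. n u)"
      unfolding E_def
    proof (rule grid_hyperplane_packing[OF I n(1) w u0I \<open>w \<bullet> u0 \<noteq> 0\<close> _ _ B(4,3) N1])
      show "B \<subseteq> grid I n" using B(1) unfolding L_def by blast
      show "w \<bullet> b = 0" if "b \<in> B" for b using B(1) that unfolding L_def by blast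
      show "N b * norm b \<le> Cr * real m" if "b \<in> B" for b using b0[OF that] by (simp add: N_def)
      show "0 \<le> Cr * real m" using Cr by simp
    qed
    then have prodN: "(\<Prod>b\<in>B. N b) \<le> E * q"
      using iw unfolding q_def u0(2)[symmetric] \<alpha> by (simp add: pos_le_divide_eq mult.commute)
    have "coverable (lattice_box B (\<lambda>b. b) N) k
       (Cb * (\<Prod>b\<in>B. N b) powr (real (m - 1 - k) / real (m - 1 - 1)))"
    proof (rule box_cover_boundD[OF Cb(1) B(2,3) _ N1])
      have "card I \<le> card (Basis :: 'a set)" using I(1) by (intro card_mono) simp_all
      then show "m - 1 \<le> DIM('a)" using I(2) by simp
    qed
    moreover have "Cb * (\<Prod>b\<in>B. N b) powr (real (m - 1 - k) / real (m - 1 - 1)) \<le> (Ca * K + Cb * E) * q powr \<beta>"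
    proof -
      have "0 \<le> (\<Prod>b\<in>B. N b)" using N1 by (intro prod_nonneg) force
      then have "(\<Prod>b\<in>B. N b) powr \<beta> \<le> (E * q) powr \<beta>" using prodN \<beta> by (intro powr_mono2)
      also have "\<dots> = E powr \<beta> * q powr \<beta>" using E q0 by (simp add: powr_mult)
      also have "\<dots> \<le> E * q powr \<beta>" using powr_le_self[OF E \<beta>] qp by (rule mult_right_mono)
      finally have "Cb * (\<Prod>b\<in>B. N b) powr \<beta> \<le> Cb * (E * q powr \<beta>)"
        using Cb(2) by (intro mult_left_mono) simp_all
      also have "\<dots> = (Cb * E) * q powr \<beta>" by simp
      also have "\<dots> \<le> (Ca * K + Cb * E) * q powr \<beta>"
        using Ca(2) K(1) qp by (intro mult_right_mono) simp_all
      moreover have "m - 1 - 1 = m - 2" by simp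
      ultimately show ?thesis unfolding \<beta>_def by simp
    qed
    ultimately show ?thesis using Xbox by (meson coverable_mono order_refl)
  qed
  then show ?thesis unfolding X_def E_def q_def \<beta>_def .
qed

subsection \<open>Covering a box\<close>

lemma infnorm_le_iff:
  fixes w :: "'a::euclidean_space"
  shows "infnorm w \<le> r \<longleftrightarrow> (\<forall>u\<in>Basis. \<bar>w \<bullet> u\<bar> \<le> r)"
  unfolding infnorm_Max by (subst Max_le_iff) simp_all

text \<open>The exponents are balanced so that the sum over the dual hyperplanes, of which at most
  \<open>O(r)\<close> have size at most \<open>r\<close>, is dominated by the largest ones.\<close>

lemma coverable_balanced_box:
  assumes k: "2 \<le> k" "k < m"
    and Ca: "k \<le> m - 2 \<Longrightarrow> box_cover_bound TYPE('a::euclidean_space) (m - 2) k Ca" "Ca \<ge> 1"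
    and Cb: "box_cover_bound TYPE('a) (m - 1) k Cb" "Cb \<ge> 1"
  shows "\<exists>D\<ge>1. \<forall>I (n :: 'a \<Rightarrow> real) \<alpha>. I \<subseteq> Basis \<longrightarrow> card I = m \<longrightarrow>
    (\<forall>u\<in>I. 1 \<le> n u \<and> n u \<le> \<alpha>) \<longrightarrow> \<alpha> ^ (m - 1) = (\<Prod>u\<in>I. n u) \<longrightarrow>
    coverable (lattice_box I (\<lambda>u. (1 / n u) *\<^sub>R u) n) k (D * \<alpha> ^ (m - k))"
proof -
  obtain Cr where Cr: "Cr \<ge> 1"
    and R: "\<And>L::'a set. discrete_subgroup L \<Longrightarrow> dim L = m - 1 \<Longrightarrow>
     (\<exists>B\<subseteq>L. finite B \<and> card B = m - 1 \<and> independent B \<and>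
        (\<forall>x\<in>L. \<exists>c::'a \<Rightarrow> int. x = (\<Sum>b\<in>B. of_int (c b) *\<^sub>R b) \<and>
           (\<forall>b\<in>B. \<bar>of_int (c b)\<bar> * norm b \<le> Cr * norm x)))"
    using reduced_basis[of "m - 1", where 'a = 'a] by blast
  \<comment> \<open>The factor by which \<open>grid_annihilator\<close> exceeds
    \<open>\<alpha>\<close>.\<close>
  define K where "K = real (2 * m + 1)"
  \<comment> \<open>The constant of \<open>grid_small_points\<close> at
    \<open>T = K * \<alpha>\<close>: the power of \<open>\<alpha>\<close> cancels against the
    product of the sides.\<close>
  define A where "A = real m * 3 ^ m * K ^ (m - 1)"
  define D0 where "D0 = Ca * K + Cb * (3 * (1 + 2 * real m * (Cr * real m))) ^ m"
  define \<beta> where "\<beta> = real (m - 1 - k) / real (m - 2)"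
  \<comment> \<open>The strict inequality uses \<open>k \<ge> 2\<close> and keeps the sum over
    \<open>Y\<close> free of a logarithm.\<close>
  have \<beta>: "0 \<le> \<beta>" "\<beta> < 1" using k by (simp_all add: \<beta>_def divide_less_eq_1)
  have K1: "K \<ge> 1" by (simp add: K_def)
  have A1: "A \<ge> 1"
  proof -
    have "1 * 1 * 1 \<le> A" unfolding A_def using k K1 by (intro mult_mono one_le_power) simp_all
    then show ?thesis by simp
  qed
  have D0: "D0 \<ge> 0" unfolding D0_def using Ca(2) Cb(2) K1 Cr by (intro add_nonneg_nonneg mult_nonneg_nonneg zero_le_power) simp_all
  \<comment> \<open>The factors come from \<open>A powr \<beta> \<le> A\<close> and
    \<open>(A * K) powr (1 - \<beta>) \<le> A * K\<close>, and \<open>1 / (1 - \<beta>)\<close> from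
    the summation lemma.\<close>
  define D where "D = max 1 (D0 * (A * (A * K)) / (1 - \<beta>))"
  have "coverable (lattice_box I (\<lambda>u. (1 / n u) *\<^sub>R u) n) k (D * \<alpha> ^ (m - k))"
    if I: "I \<subseteq> Basis" "card I = m" and n: "\<forall>u\<in>I. 1 \<le> n u \<and> n u \<le> \<alpha>" and \<alpha>: "\<alpha> ^ (m - 1) = (\<Prod>u\<in>I. n u)"
    for I and n :: "'a \<Rightarrow> real" and \<alpha>
  proof -
    have n1: "1 \<le> n u" and n\<alpha>: "n u \<le> \<alpha>" and n0: "0 < n u" if "u \<in> I" for u
      using n that by force+
    have "I \<noteq> {}" using I(2) k by auto
    then have \<alpha>1: "\<alpha> \<ge> 1" using n1 n\<alpha> by force
    define T where "T = K * \<alpha>"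
    have T\<alpha>: "\<alpha> \<le> T" using \<alpha>1 K1 unfolding T_def by (simp add: mult_le_cancel_right1)
    have T0: "T > 0" using T\<alpha> \<alpha>1 by linarith
    have nT: "n u \<le> T" if "u \<in> I" for u using n\<alpha>[OF that] T\<alpha> by linarith
    define G where "G = grid I (\<lambda>u. 1 / n u)"
    have Gdisc: "discrete_subgroup G"
      unfolding G_def using n0 by (intro discrete_subgroup_grid[OF I(1)]) simp
    define Y where "Y = {w. primitive G w \<and> (\<forall>u\<in>I. \<bar>w \<bullet> u\<bar> \<le> T)}"
    have Yprim: "primitive G w" if "w \<in> Y" for w using that unfolding Y_def by blast
    have YG: "w \<in> G" "w \<noteq> 0" if "w \<in> Y" for w using Yprim[OF that] unfolding primitive_def by blast+
    have P0: "(\<Prod>u\<in>I. n u) > 0" using n0 by (intro prod_pos) blast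
    have Aeq: "real m * 3 ^ m * T ^ (m - 1) / (\<Prod>u\<in>I. n u) = A"
      using P0 unfolding A_def T_def power_mult_distrib \<alpha> by simp
    have small: "finite {w \<in> G. w \<noteq> 0 \<and> (\<forall>u\<in>I. \<bar>w \<bullet> u\<bar> \<le> r)}"
      "real (card {w \<in> G. w \<noteq> 0 \<and> (\<forall>u\<in>I. \<bar>w \<bullet> u\<bar> \<le> r)}) \<le> A * r" if "0 \<le> r" "r \<le> T" for r
      using grid_small_points[where n = n, OF I n0 nT that] unfolding Aeq G_def by blast+
    have Ysub: "Y \<subseteq> {w \<in> G. w \<noteq> 0 \<and> (\<forall>u\<in>I. \<bar>w \<bullet> u\<bar> \<le> T)}" using YG unfolding Y_def by blast
    have finY: "finite Y" using Ysub small(1)[of T] T0 finite_subset by fastforce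
    have "card Y \<le> card {w \<in> G. w \<noteq> 0 \<and> (\<forall>u\<in>I. \<bar>w \<bullet> u\<bar> \<le> T)}"
      using small(1)[of T] T0 Ysub by (intro card_mono) simp_all
    then have cardY: "real (card Y) \<le> A * T" using small(2)[of T] T0 by linarith
    \<comment> \<open>Beyond \<open>T\<close> there are no further vectors in \<open>Y\<close>, so
      the bound at \<open>T\<close> persists for every larger \<open>r\<close>.\<close>
    have growth: "real (card {w \<in> Y. infnorm w \<le> r}) \<le> A * r" if r: "r > 0" for r
    proof (cases "r \<le> T")
      case True
      have "{w \<in> Y. infnorm w \<le> r} \<subseteq> {w \<in> G. w \<noteq> 0 \<and> (\<forall>u\<in>I. \<bar>w \<bullet> u\<bar> \<le> r)}"
        using YG I(1) unfolding infnorm_le_iff by blast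
      then have "card {w \<in> Y. infnorm w \<le> r} \<le> card {w \<in> G. w \<noteq> 0 \<and> (\<forall>u\<in>I. \<bar>w \<bullet> u\<bar> \<le> r)}"
        using small(1)[of r] True r by (intro card_mono) simp_all
      then show ?thesis using small(2)[of r] True r by linarith
    next
      case False
      have "card {w \<in> Y. infnorm w \<le> r} \<le> card Y" using finY by (intro card_mono) simp_all
      moreover have "A * T \<le> A * r" using False A1 by (intro mult_left_mono) simp_all
      ultimately show ?thesis using cardY by linarith
    qed
    define t where "t w = D0 * (\<alpha> ^ (m - 1) / infnorm w) powr \<beta>" for w :: 'a
    define X where "X = lattice_box I (\<lambda>u. (1 / n u) *\<^sub>R u) n"
    have "coverable X k (\<Sum>w\<in>Y. t w)"
    proof (rule coverable_UN[OF finY])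
      fix w assume w: "w \<in> Y"
      have "infnorm w \<le> K * \<alpha>"
        unfolding infnorm_le_iff
      proof
        fix u :: 'a assume u: "u \<in> Basis"
        show "\<bar>w \<bullet> u\<bar> \<le> K * \<alpha>"
        proof (cases "u \<in> I")
          case True
          then show ?thesis using w unfolding Y_def T_def by blast
        next
          case False
          then have "w \<bullet> u = 0" using YG(1)[OF w] u unfolding G_def grid_def by blast
          then show ?thesis using T0 unfolding T_def by simp
        qed
      qed
      then show "coverable {x \<in> X. w \<bullet> x = 0} k (t w)"
        using coverable_hyperplane_section[OF I n1 n\<alpha> \<alpha> k Ca Cb R Cr _ K1] Yprim[OF w]
        unfolding X_def t_def D0_def \<beta>_def G_def by blast
    next
      show "X \<subseteq> (\<Union>w\<in>Y. {x \<in> X. w \<bullet> x = 0})"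
      proof
        fix x assume x: "x \<in> X"
        then have xg: "x \<in> grid I n" "\<And>u. u \<in> I \<Longrightarrow> \<bar>x \<bullet> u\<bar> \<le> 1"
          using lattice_box_subset_grid[where n = n, OF I(1) n0] unfolding X_def by blast+
        have "2 \<le> m" using k by linarith
        from grid_annihilator[where n = n, OF I this n0 \<alpha>1 \<alpha> xg]
        obtain w where w: "w \<in> G" "w \<noteq> 0" "w \<bullet> x = 0" "\<forall>u\<in>I. \<bar>w \<bullet> u\<bar> \<le> T"
          unfolding G_def T_def K_def by blast
        obtain s where s: "\<bar>s\<bar> \<le> 1" "primitive G (s *\<^sub>R w)"
          using primitive_multiple_exists[OF Gdisc w(1,2)] by blast
        have "\<bar>(s *\<^sub>R w) \<bullet> u\<bar> \<le> T" if u: "u \<in> I" for u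
        proof -
          have "\<bar>s\<bar> * \<bar>w \<bullet> u\<bar> \<le> 1 * T" using s(1) w(4) u by (intro mult_mono) simp_all
          then show ?thesis by (simp add: abs_mult)
        qed
        then have "s *\<^sub>R w \<in> Y" using s(2) unfolding Y_def by blast
        moreover have "(s *\<^sub>R w) \<bullet> x = 0" using w(3) by simp
        ultimately show "x \<in> (\<Union>w\<in>Y. {x \<in> X. w \<bullet> x = 0})" using x by blast
      qed
    qed
    moreover have "(\<Sum>w\<in>Y. t w) \<le> D * \<alpha> ^ (m - k)"
    proof -
      have ipos: "infnorm w > 0" if "w \<in> Y" for w using YG(2)[OF that] by (simp add: infnorm_pos_lt)
      have "(\<Sum>w\<in>Y. t w) = (\<Sum>w\<in>Y. D0 * (\<alpha> ^ (m - 1)) powr \<beta> * infnorm w powr (-\<beta>))"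
      proof (rule sum.cong[OF refl])
        fix w :: 'a
        have "(\<alpha> ^ (m - 1) / infnorm w) powr \<beta> = (\<alpha> ^ (m - 1)) powr \<beta> / infnorm w powr \<beta>"
          by (rule powr_divide)
        then show "t w = D0 * (\<alpha> ^ (m - 1)) powr \<beta> * infnorm w powr (-\<beta>)"
          unfolding t_def by (simp add: powr_minus divide_inverse)
      qed
      also have "\<dots> = D0 * (\<alpha> ^ (m - 1)) powr \<beta> * (\<Sum>w\<in>Y. infnorm w powr (-\<beta>))"
        by (simp add: sum_distrib_left)
      also have "\<dots> \<le> D0 * (\<alpha> ^ (m - 1)) powr \<beta> * (A * (A * K) * \<alpha> powr (1 - \<beta>) / (1 - \<beta>))"
      proof (rule mult_left_mono)
        have "(\<Sum>w\<in>Y. infnorm w powr (-\<beta>)) \<le> A powr \<beta> * real (card Y) powr (1 - \<beta>) / (1 - \<beta>)"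
          using finY ipos growth \<beta> A1 by (intro sum_powr_le_of_linear_growth) simp_all
        also have "\<dots> \<le> A * (A * K * \<alpha> powr (1 - \<beta>)) / (1 - \<beta>)"
        proof (rule divide_right_mono, rule mult_mono)
          show "A powr \<beta> \<le> A" using A1 \<beta> by (intro powr_le_self) simp_all
          have "real (card Y) powr (1 - \<beta>) \<le> (A * K * \<alpha>) powr (1 - \<beta>)"
            using cardY \<beta> unfolding T_def by (intro powr_mono2) (simp_all add: mult_ac)
          also have "\<dots> = (A * K) powr (1 - \<beta>) * \<alpha> powr (1 - \<beta>)"
            by (rule powr_mult)
          also have "(A * K) powr (1 - \<beta>) \<le> A * K"
          proof (rule powr_le_self)
            have "1 * 1 \<le> A * K" using A1 K1 by (intro mult_mono) simp_all
            then show "1 \<le> A * K" by simp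
          qed (use \<beta> in simp_all)
          then have "(A * K) powr (1 - \<beta>) * \<alpha> powr (1 - \<beta>) \<le> A * K * \<alpha> powr (1 - \<beta>)"
            by (intro mult_right_mono) simp_all
          finally show "real (card Y) powr (1 - \<beta>) \<le> A * K * \<alpha> powr (1 - \<beta>)" .
        qed (use A1 K1 \<beta> in simp_all)
        finally show "(\<Sum>w\<in>Y. infnorm w powr (-\<beta>)) \<le> A * (A * K) * \<alpha> powr (1 - \<beta>) / (1 - \<beta>)"
          by (simp add: mult.assoc)
      qed (use D0 in simp)
      also have "\<dots> = D0 * (A * (A * K)) / (1 - \<beta>) * ((\<alpha> ^ (m - 1)) powr \<beta> * \<alpha> powr (1 - \<beta>))"
        by simp
      \<comment> \<open>The balance of exponents: \<open>(m - 1) * \<beta> + 1 - \<beta> = (m - 2) *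
        \<beta> + 1 = (m - 1 - k) + 1 = m - k\<close>.\<close>
      also have "(\<alpha> ^ (m - 1)) powr \<beta> * \<alpha> powr (1 - \<beta>) = \<alpha> ^ (m - k)"
      proof -
        have "(\<alpha> ^ (m - 1)) powr \<beta> * \<alpha> powr (1 - \<beta>) = \<alpha> powr (real (m - 1) * \<beta> + (1 - \<beta>))"
          using \<alpha>1 by (simp add: powr_realpow[symmetric] powr_powr powr_add)
        also have "real (m - 1) * \<beta> + (1 - \<beta>) = real (m - 2) * \<beta> + 1"
          using k by (simp add: of_nat_diff algebra_simps)
        also have "real (m - 2) * \<beta> = real (m - 1 - k)" using k by (simp add: \<beta>_def)
        also have "real (m - 1 - k) + 1 = real (m - k)" using k by (simp add: of_nat_diff)
        finally show ?thesis using \<alpha>1 by (simp add: powr_realpow)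
      qed
      also have "D0 * (A * (A * K)) / (1 - \<beta>) * \<alpha> ^ (m - k) \<le> D * \<alpha> ^ (m - k)"
        unfolding D_def using \<alpha>1 by (intro mult_right_mono) simp_all
      finally show ?thesis .
    qed
    ultimately show ?thesis unfolding X_def by (meson coverable_mono order_refl)
  qed
  moreover have "D \<ge> 1" by (simp add: D_def)
  ultimately show ?thesis by blast
qed

text \<open>\<open>k\<close> varies in the induction: a long side leads to
  \<open>(m - 1, k - 1)\<close>, a spanning hyperplane section to \<open>(m - 1, k)\<close>, a
  degenerate one to \<open>(m - 2, k)\<close>. The cases \<open>k = m\<close>, with a single
  subspace, and \<open>k = 1\<close>, with one line per point, are direct.\<close>

lemma box_cover_bound_exists:
  assumes "1 \<le> k" "k \<le> m" "m \<le> DIM('a::euclidean_space)"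
  shows "\<exists>C\<ge>1. box_cover_bound TYPE('a) m k C"
  using assms
proof (induction m arbitrary: k rule: less_induct)
  case (less m)
  have fin: "finite I" if "I \<subseteq> (Basis :: 'a set)" for I using that finite_subset[OF _ finite_Basis] by blast
  have prod1: "1 \<le> (\<Prod>u\<in>I. n u)" if "\<forall>u\<in>I. 1 \<le> n u" for I and n :: "'a \<Rightarrow> real"
    using that by (intro prod_ge_1) blast
  consider "k = m" | "k = 1" "k < m" | "2 \<le> k" "k < m" using less.prems(1,2) by linarith
  then show ?case
  proof cases
    \<comment> \<open>This includes \<open>m = 1\<close>, where the exponent is
      \<open>0 / 0 = 0\<close>.\<close>
    case 1
    have "box_cover_bound TYPE('a) m k 1"
      unfolding box_cover_bound_def
    proof (intro allI impI, elim conjE)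
      fix I and F :: "'a \<Rightarrow> 'a" and n :: "'a \<Rightarrow> real"
      assume I: "I \<subseteq> Basis" "card I = m" and n: "\<forall>u\<in>I. 1 \<le> n u"
      have "lattice_box I F n \<subseteq> span (F ` I)"
        unfolding lattice_box_def by (auto intro!: span_sum span_scale intro: span_base)
      then have "dim (lattice_box I F n) \<le> card (F ` I)" using fin[OF I(1)] by (intro dim_le_card) simp_all
      also have "\<dots> \<le> k" using card_image_le[OF fin[OF I(1)], of F] I(2) 1 by simp
      finally show "coverable (lattice_box I F n) k (1 * (\<Prod>u\<in>I. n u) powr (real (m - k) / real (m - 1)))"
        using prod1[OF n] 1 by (intro coverable_single) simp_all
    qed
    then show ?thesis by (intro exI[of _ 1]) simp
  next
    case 2
    have "box_cover_bound TYPE('a) m k (3 ^ m)"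
      unfolding box_cover_bound_def
    proof (intro allI impI, elim conjE)
      fix I and F :: "'a \<Rightarrow> 'a" and n :: "'a \<Rightarrow> real"
      assume I: "I \<subseteq> Basis" "card I = m" and n: "\<forall>u\<in>I. 1 \<le> n u"
      have n0: "0 < n u" if "u \<in> I" for u using n that by force
      obtain g where g: "linear g" "lattice_box I F n = g ` lattice_box I (\<lambda>u. (1 / n u) *\<^sub>R u) n"
        using lattice_box_eq_linear_image[where n = n, OF I(1) n0] by blast
      define Z where "Z = {x \<in> grid I n. \<forall>u\<in>I. \<bar>x \<bullet> u\<bar> \<le> 1}"
      have "finite Z" unfolding Z_def by (rule grid_ball(1)[OF I(1) n0]) simp_all
      moreover have "real (card Z) \<le> 3 ^ m * (\<Prod>u\<in>I. n u)"
      proof -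
        have "real (card Z) \<le> (\<Prod>u\<in>I. 2 * (1 * n u) + 1)"
          unfolding Z_def by (rule grid_ball(2)[OF I(1) n0]) simp_all
        also have "\<dots> \<le> (\<Prod>u\<in>I. 3 * n u)" using n by (intro prod_mono) force
        finally show ?thesis using I(2) by (simp add: prod.distrib)
      qed
      ultimately have "coverable Z k (3 ^ m * (\<Prod>u\<in>I. n u))" using 2 by (intro coverable_points) simp_all
      then have "coverable (lattice_box I (\<lambda>u. (1 / n u) *\<^sub>R u) n) k (3 ^ m * (\<Prod>u\<in>I. n u))"
        using lattice_box_subset_grid[where n = n, OF I(1) n0] unfolding Z_def by (meson coverable_mono order_refl)
      then have "coverable (lattice_box I F n) k (3 ^ m * (\<Prod>u\<in>I. n u))"
        unfolding g(2) by (rule coverable_linear_image[OF g(1)])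
      moreover have "(\<Prod>u\<in>I. n u) powr (real (m - k) / real (m - 1)) = (\<Prod>u\<in>I. n u)"
        using 2 prod1[OF n] by simp
      ultimately show "coverable (lattice_box I F n) k (3 ^ m * (\<Prod>u\<in>I. n u) powr (real (m - k) / real (m - 1)))"
        by simp
    qed
    moreover have "(1::real) \<le> 3 ^ m" by simp
    ultimately show ?thesis by blast
  next
    case 3
    have b: "m - 1 < m" "1 \<le> k - 1" "k - 1 \<le> m - 1" "k \<le> m - 1" "m - 1 \<le> DIM('a)"
      using less.prems 3 by linarith+
    obtain C1 where C1: "C1 \<ge> 1" "box_cover_bound TYPE('a) (m - 1) (k - 1) C1"
      using less.IH[OF b(1,2,3,5)] by blast
    obtain Cb where Cb: "Cb \<ge> 1" "box_cover_bound TYPE('a) (m - 1) k Cb"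
      using less.IH[OF b(1) less.prems(1) b(4,5)] by blast
    \<comment> \<open>For \<open>k = m - 1\<close> there is no instance in dimension
      \<open>m - 2\<close>, and any constant at least 1 serves as \<open>Ca\<close>.\<close>
    have "\<exists>Ca\<ge>1. k \<le> m - 2 \<longrightarrow> box_cover_bound TYPE('a) (m - 2) k Ca"
    proof (cases "k \<le> m - 2")
      case True
      have "m - 2 < m" "m - 2 \<le> DIM('a)" using less.prems 3 by linarith+
      then show ?thesis using less.IH[OF _ less.prems(1) True] by blast
    qed auto
    then obtain Ca where Ca: "Ca \<ge> 1" "k \<le> m - 2 \<Longrightarrow> box_cover_bound TYPE('a) (m - 2) k Ca" by blast
    obtain D where D: "D \<ge> 1" "\<And>I (n :: 'a \<Rightarrow> real) \<alpha>. I \<subseteq> Basis \<Longrightarrow> card I = m \<Longrightarrow>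
      (\<forall>u\<in>I. 1 \<le> n u \<and> n u \<le> \<alpha>) \<Longrightarrow> \<alpha> ^ (m - 1) = (\<Prod>u\<in>I. n u) \<Longrightarrow>
      coverable (lattice_box I (\<lambda>u. (1 / n u) *\<^sub>R u) n) k (D * \<alpha> ^ (m - k))"
      using coverable_balanced_box[OF 3 Ca(2,1) Cb(2,1)] by blast
    have "box_cover_bound TYPE('a) m k (max C1 D)"
      unfolding box_cover_bound_def
    proof (intro allI impI, elim conjE)
      fix I and F :: "'a \<Rightarrow> 'a" and n :: "'a \<Rightarrow> real"
      assume I: "I \<subseteq> Basis" "card I = m" and n: "\<forall>u\<in>I. 1 \<le> n u"
      have n0: "0 < n u" if "u \<in> I" for u using n that by force
      define P where "P = (\<Prod>u\<in>I. n u)"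
      have P1: "P \<ge> 1" unfolding P_def using n by (rule prod1)
      define \<alpha> where "\<alpha> = P powr (1 / real (m - 1))"
      have \<alpha>1: "\<alpha> \<ge> 1" unfolding \<alpha>_def using P1 by (intro ge_one_powr_ge_zero) simp_all
      have \<alpha>P: "\<alpha> ^ (m - 1) = P"
      proof -
        have "\<alpha> ^ (m - 1) = \<alpha> powr real (m - 1)" using \<alpha>1 by (simp add: powr_realpow)
        also have "\<dots> = P" unfolding \<alpha>_def powr_powr using P1 3 by simp
        finally show ?thesis .
      qed
      have target: "P powr (real (m - k) / real (m - 1)) = \<alpha> ^ (m - k)"
        unfolding \<alpha>P[symmetric] using \<alpha>1 3 by (intro powr_quotient_of_power) simp_all
      have "coverable (lattice_box I F n) k (max C1 D * \<alpha> ^ (m - k))"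
      proof (cases "\<forall>u\<in>I. n u \<le> \<alpha>")
        case True
        obtain g where g: "linear g" "lattice_box I F n = g ` lattice_box I (\<lambda>u. (1 / n u) *\<^sub>R u) n"
          using lattice_box_eq_linear_image[where n = n, OF I(1) n0] by blast
        have "coverable (lattice_box I (\<lambda>u. (1 / n u) *\<^sub>R u) n) k (D * \<alpha> ^ (m - k))"
          using True n \<alpha>P unfolding P_def by (intro D(2)[OF I]) simp_all
        then have "coverable (lattice_box I F n) k (D * \<alpha> ^ (m - k))"
          unfolding g(2) by (rule coverable_linear_image[OF g(1)])
        moreover have "D * \<alpha> ^ (m - k) \<le> max C1 D * \<alpha> ^ (m - k)"
          using \<alpha>1 by (intro mult_right_mono) simp_all
        ultimately show ?thesis by (meson coverable_mono order_refl)
      next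
        case False
        then obtain u where u: "u \<in> I" "n u > \<alpha>" by force
        define J where "J = I - {u}"
        have J: "J \<subseteq> Basis" "card J = m - 1" "\<forall>u\<in>J. 1 \<le> n u"
          using I u n fin[OF I(1)] by (auto simp: J_def)
        have "coverable (lattice_box J F n) (k - 1)
          (C1 * (\<Prod>u\<in>J. n u) powr (real (m - 1 - (k - 1)) / real (m - 1 - 1)))"
          using C1(2) J unfolding box_cover_bound_def by blast
        then have "coverable (lattice_box I F n) (k - 1 + card (I - J))
          (C1 * (\<Prod>u\<in>J. n u) powr (real (m - 1 - (k - 1)) / real (m - 1 - 1)))"
          using fin[OF I(1)] by (intro coverable_lattice_box_subset) (auto simp: J_def)
        moreover have "k - 1 + card (I - J) = k"
        proof -
          have "I - J = {u}" using u(1) by (auto simp: J_def)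
          then show ?thesis using 3 by simp
        qed
        \<comment> \<open>Since \<open>n u > \<alpha>\<close>, the other sides have product at most
          \<open>\<alpha> ^ (m - 2)\<close>; the exponent \<open>(m - k) / (m - 2)\<close> of the
          smaller box turns this into exactly \<open>\<alpha> ^ (m - k)\<close>.\<close>
        moreover have "C1 * (\<Prod>u\<in>J. n u) powr (real (m - 1 - (k - 1)) / real (m - 1 - 1))
            \<le> max C1 D * \<alpha> ^ (m - k)"
        proof (rule mult_mono)
          have e: "m - 1 - (k - 1) = m - k" "m - 1 - 1 = m - 2" "m - 1 = Suc (m - 2)" using 3 by simp_all
          have "n u * (\<Prod>u\<in>J. n u) = \<alpha> * \<alpha> ^ (m - 2)"
            using fin[OF I(1)] u(1) \<alpha>P unfolding J_def P_def e(3) by (simp add: prod.remove)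
          also have "\<dots> \<le> n u * \<alpha> ^ (m - 2)" using u(2) \<alpha>1 by (intro mult_right_mono) simp_all
          finally have "(\<Prod>u\<in>J. n u) \<le> \<alpha> ^ (m - 2)" using n0[OF u(1)] by simp
          moreover have "0 \<le> (\<Prod>u\<in>J. n u)" using prod1[OF J(3)] by linarith
          ultimately have "(\<Prod>u\<in>J. n u) powr (real (m - k) / real (m - 2))
              \<le> (\<alpha> ^ (m - 2)) powr (real (m - k) / real (m - 2))"
            by (intro powr_mono2) simp_all
          also have "\<dots> = \<alpha> ^ (m - k)" using \<alpha>1 3 by (intro powr_quotient_of_power) simp_all
          finally show "(\<Prod>u\<in>J. n u) powr (real (m - 1 - (k - 1)) / real (m - 1 - 1)) \<le> \<alpha> ^ (m - k)"
            unfolding e(1,2) .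
        qed (use C1 in simp_all)
        ultimately show ?thesis by (metis coverable_mono order_refl)
      qed
      then show "coverable (lattice_box I F n) k
          (max C1 D * (\<Prod>u\<in>I. n u) powr (real (m - k) / real (m - 1)))"
        using target unfolding P_def by simp
    qed
    moreover have "1 \<le> max C1 D" using D(1) by simp
    ultimately show ?thesis by blast
  qed
qed

subsection \<open>Successive minima\<close>

lemma superspace_of_dim:
  fixes V :: "'a::euclidean_space set"
  assumes "subspace V" "dim V \<le> k" "k \<le> DIM('a)"
  shows "\<exists>W. subspace W \<and> dim W = k \<and> V \<subseteq> W"
proof -
  obtain B where B: "B \<subseteq> V" "independent B" "V \<subseteq> span B" "card B = dim V"
    by (rule basis_exists)
  obtain B' where B': "B \<subseteq> B'" "independent B'" "UNIV \<subseteq> span B'"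
    by (rule maximal_independent_subset_extend[OF subset_UNIV B(2)])
  have fin: "finite B'" using B'(2) by (rule independent_imp_finite)
  have finB: "finite B" using B'(1) fin by (rule finite_subset)
  have "span B' = span (UNIV :: 'a set)" using B'(3) by (simp add: top.extremum_unique)
  then have "dim (UNIV :: 'a set) = card B'" using B'(2) by (rule dim_eq_card)
  then have "card B' = DIM('a)" by simp
  then have "k - card B \<le> card (B' - B)"
    using assms(3) card_Diff_subset[OF finB B'(1)] by simp
  then obtain E where E: "E \<subseteq> B' - B" "card E = k - card B" "finite E"
    using obtain_subset_with_card_n by blast
  have "B \<union> E \<subseteq> B'" using E(1) B'(1) by blast
  then have "independent (B \<union> E)" using B'(2) by (rule independent_mono[rotated])
  then have "dim (span (B \<union> E)) = card (B \<union> E)" unfolding dim_span by (rule dim_eq_card_independent)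
  also have "\<dots> = card B + card E"
    using E(1) by (intro card_Un_disjoint finB E(3)) blast
  also have "\<dots> = k" using E(2) B(4) assms(2) by simp
  finally have "dim (span (B \<union> E)) = k" .
  moreover have "V \<subseteq> span (B \<union> E)" using B(3) span_mono[of B "B \<union> E"] by blast
  ultimately show ?thesis using subspace_span by blast
qed

lemma coverable_exact_dim:
  fixes X :: "'a::euclidean_space set"
  assumes "coverable X k t" "k \<le> DIM('a)"
  shows "\<exists>S. finite S \<and> (\<forall>V\<in>S. subspace V \<and> dim V = k) \<and> X \<subseteq> \<Union>S \<and> real (card S) \<le> t"
proof -
  obtain S where S: "finite S" "\<And>V. V \<in> S \<Longrightarrow> subspace V \<and> dim V \<le> k" "X \<subseteq> \<Union>S" "real (card S) \<le> t"
    using assms(1) unfolding coverable_def by blast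
  have "\<forall>V\<in>S. \<exists>W. subspace W \<and> dim W = k \<and> V \<subseteq> W"
    using S(2) superspace_of_dim[OF _ _ assms(2)] by blast
  then obtain W where W: "\<And>V. V \<in> S \<Longrightarrow> subspace (W V) \<and> dim (W V) = k \<and> V \<subseteq> W V" by metis
  have "card (W ` S) \<le> card S" using S(1) by (rule card_image_le)
  then have "real (card (W ` S)) \<le> t" using S(4) by linarith
  moreover have "X \<subseteq> \<Union>(W ` S)" using S(3) W by blast
  ultimately show ?thesis using S(1) W by (intro exI[of _ "W ` S"]) auto
qed

text \<open>A linear map taking the basis of \<open>L\<close> to the standard basis is injective and
  bounded and sends \<open>L\<close> into the integer grid; finiteness in balls is pulled back along
  it.\<close>

lemma is_lattice_discrete_subgroup:
  fixes L :: "'a::euclidean_space set"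
  assumes "is_lattice L"
  shows "discrete_subgroup L" and "dim L = DIM('a)"
proof -
  obtain B where B: "independent B" "card B = DIM('a)"
    and L: "L = {(\<Sum>b\<in>B. of_int (c b) *\<^sub>R b) | c. True}"
    using assms unfolding is_lattice_def by (elim exE conjE) (rule that)
  have Lc: "x \<in> L \<longleftrightarrow> (\<exists>c :: 'a \<Rightarrow> int. x = (\<Sum>b\<in>B. of_int (c b) *\<^sub>R b))" for x
    by (simp only: L mem_Collect_eq simp_thms)
  have mem: "(\<Sum>b\<in>B. of_int (c b) *\<^sub>R b) \<in> L" for c
    unfolding Lc by (intro exI[of _ c] refl)
  have fin: "finite B" using B(1) by (rule independent_imp_finite)
  have BL: "B \<subseteq> L"
  proof
    fix b assume b: "b \<in> B"
    have eq: "(\<Sum>v\<in>B. of_int (if v = b then 1 else 0) *\<^sub>R v) = (\<Sum>v\<in>B. if v = b then v else 0)"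
      by (intro sum.cong) simp_all
    show "b \<in> L" using mem[of "\<lambda>v. if v = b then 1 else 0"] fin b unfolding eq by simp
  qed
  show "dim L = DIM('a)"
    using independent_card_le_dim[OF BL B(1)] B(2) dim_subset_UNIV[of L] by linarith
  have LB: "L \<subseteq> span B"
  proof
    fix x assume "x \<in> L"
    then obtain c where c: "x = (\<Sum>b\<in>B. of_int (c b) *\<^sub>R b)" unfolding Lc by (elim exE)
    show "x \<in> span B" unfolding c by (intro span_sum span_scale span_base)
  qed
  obtain h where h: "bij_betw h B (Basis :: 'a set)"
    using finite_same_card_bij[OF fin finite_Basis B(2)] by blast
  obtain g where g: "linear g" "\<And>b. b \<in> B \<Longrightarrow> g b = h b"
    using linear_independent_extend[OF B(1), of h] by blast
  have "bij_betw g B Basis = bij_betw h B Basis" using g(2) by (rule bij_betw_cong)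
  then have "bij_betw g B Basis" using h by simp
  then have gB: "g ` B = Basis" "inj_on g B" unfolding bij_betw_def by blast+
  have inj: "inj_on g (span B)"
    using gB independent_Basis by (intro linear_inj_on_span_independent_image[OF g(1)]) simp_all
  obtain K where K: "\<And>x. norm (g x) \<le> K * norm x" "K > 0"
    using linear_bounded_pos[OF g(1)] by blast
  have gL: "g ` L \<subseteq> grid Basis (\<lambda>_. 1)"
  proof clarify
    fix x assume "x \<in> L"
    then obtain c where c: "x = (\<Sum>b\<in>B. of_int (c b) *\<^sub>R b)" unfolding Lc by (elim exE)
    have "g x = (\<Sum>b\<in>B. of_int (c b) *\<^sub>R g b)" unfolding c using g(1) by (simp add: linear_sum linear_scale)
    also have "\<dots> \<in> grid Basis (\<lambda>_. 1)"
    proof (rule grid_sum)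
      fix b assume "b \<in> B"
      then have "g b \<in> Basis" using gB(1) by blast
      then show "g b \<in> grid Basis (\<lambda>_. 1)"
        using grid_generator[of Basis "g b" "\<lambda>_. 1"] by simp
    qed
    finally show "g x \<in> grid Basis (\<lambda>_. 1)" .
  qed
  show "discrete_subgroup L"
    unfolding discrete_subgroup_def
  proof (intro conjI ballI allI)
    show "0 \<in> L" using mem[of "\<lambda>_. 0"] by simp
    show "x - y \<in> L" if xy: "x \<in> L" "y \<in> L" for x y
    proof -
      obtain c where c: "x = (\<Sum>b\<in>B. of_int (c b) *\<^sub>R b)" using xy(1) unfolding Lc by (elim exE)
      obtain c' where c': "y = (\<Sum>b\<in>B. of_int (c' b) *\<^sub>R b)" using xy(2) unfolding Lc by (elim exE)
      have "x - y = (\<Sum>b\<in>B. of_int (c b - c' b) *\<^sub>R b)"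
        by (simp add: c c' scaleR_diff_left sum_subtractf)
      then show ?thesis using mem[of "\<lambda>b. c b - c' b"] by (simp only:)
    qed
    fix r :: real
    have "g ` (L \<inter> cball 0 r) \<subseteq> grid Basis (\<lambda>_. 1) \<inter> cball 0 (K * r)"
    proof clarify
      fix x assume x: "x \<in> L" "x \<in> cball 0 r"
      have "norm (g x) \<le> K * norm x" by (rule K(1))
      also have "\<dots> \<le> K * r" using x(2) K(2) by simp
      finally have "g x \<in> cball 0 (K * r)" by simp
      moreover have "g x \<in> grid Basis (\<lambda>_. 1)" using gL x(1) by blast
      ultimately show "g x \<in> grid Basis (\<lambda>_. 1) \<inter> cball 0 (K * r)" by blast
    qed
    moreover have "finite (grid Basis (\<lambda>_. 1) \<inter> cball (0::'a) (K * r))"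
      using discrete_subgroup_grid[of "Basis :: 'a set" "\<lambda>_. 1"] unfolding discrete_subgroup_def by simp
    ultimately have "finite (g ` (L \<inter> cball 0 r))" by (rule finite_subset)
    moreover have "inj_on g (L \<inter> cball 0 r)" using inj by (rule inj_on_subset) (use LB in blast)
    ultimately show "finite (L \<inter> cball 0 r)" by (rule finite_imageD)
  qed
qed

section \<open>Comparison of successive minima with lengths of independent lattice points\<close>

lemma scaled_unit_cball:
  assumes "r > 0"
  shows "(\<lambda>x. r *\<^sub>R x) ` cball 0 1 = cball (0 :: 'a::real_normed_vector) r"
  using cball_scale[of r 0 1] assms by simp

lemma succ_min_set_member:
  fixes S :: "'a::euclidean_space set"
  assumes S: "S \<subseteq> L" "independent S" "j \<le> card S" and r: "r > 0" "\<And>s. s \<in> S \<Longrightarrow> norm s \<le> r"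
    and L: "0 \<in> L"
  shows "r \<in> {lam. lam > 0 \<and> aff_dim (L \<inter> ((\<lambda>x. lam *\<^sub>R x) ` cball 0 1)) \<ge> int j}"
proof -
  have sub: "insert 0 S \<subseteq> L \<inter> cball 0 r" using S(1) L r by auto
  have "int j \<le> int (dim (insert 0 S))"
    using S(3) dim_subset[of S "insert 0 S"] dim_eq_card_independent[OF S(2)] by force
  \<comment> \<open>Affine and linear dimension agree for sets containing 0.\<close>
  also have "\<dots> = aff_dim (insert 0 S)"
    by (rule aff_dim_zero[symmetric]) (simp add: hull_inc)
  also have "\<dots> \<le> aff_dim (L \<inter> cball 0 r)" using sub by (rule aff_dim_subset)
  finally show ?thesis using r(1) by (simp add: scaled_unit_cball)
qed

lemma succ_min_le:
  fixes S :: "'a::euclidean_space set"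
  assumes S: "S \<subseteq> L" "independent S" "j \<le> card S" and r: "r > 0" "\<And>s. s \<in> S \<Longrightarrow> norm s \<le> r"
    and L: "0 \<in> L"
  shows "succ_min L (cball 0 1) j \<le> r"
  unfolding succ_min_def
  by (rule cInf_lower[OF succ_min_set_member[OF assms]]) (auto intro!: bdd_belowI[of _ 0])

lemma succ_min_mono:
  fixes S :: "'a::euclidean_space set"
  assumes S: "S \<subseteq> L" "independent S" "j \<le> card S" and L: "0 \<in> L" and ij: "i \<le> j"
  shows "succ_min L (cball 0 1) i \<le> succ_min L (cball 0 1) j"
  unfolding succ_min_def
proof (rule cInf_superset_mono)
  have fin: "finite S" using S(2) by (rule independent_imp_finite)
  have "norm s \<le> 1 + (\<Sum>s\<in>S. norm s)" if "s \<in> S" for s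
    using member_le_sum[OF that, of norm] fin by simp
  moreover have "1 + (\<Sum>s\<in>S. norm s) > 0" by (simp add: add_pos_nonneg sum_nonneg)
  ultimately show "{lam. lam > 0 \<and> int j \<le> aff_dim (L \<inter> (\<lambda>x. lam *\<^sub>R x) ` cball 0 1)} \<noteq> {}"
    using succ_min_set_member[OF S _ _ L] by blast
  show "bdd_below {lam. 0 < lam \<and> int i \<le> aff_dim (L \<inter> (\<lambda>x. lam *\<^sub>R x) ` cball 0 1)}"
    by (auto intro!: bdd_belowI[of _ 0])
  show "{lam. 0 < lam \<and> int j \<le> aff_dim (L \<inter> (\<lambda>x. lam *\<^sub>R x) ` cball 0 1)}
    \<subseteq> {lam. 0 < lam \<and> int i \<le> aff_dim (L \<inter> (\<lambda>x. lam *\<^sub>R x) ` cball 0 1)}"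
    using ij by auto
qed

text \<open>The length of a shortest nonzero vector is a lower bound: a smaller ball meets
  \<open>L\<close> in 0 at most.\<close>

lemma succ_min_pos:
  fixes S :: "'a::euclidean_space set"
  assumes L: "discrete_subgroup L" and S: "S \<subseteq> L" "independent S" "j \<le> card S" and j: "1 \<le> j"
  shows "succ_min L (cball 0 1) j > 0"
proof -
  have L0: "0 \<in> L" using L unfolding discrete_subgroup_def by blast
  have fin: "finite S" using S(2) by (rule independent_imp_finite)
  have "S \<noteq> {}" using S(3) j by auto
  then obtain s where s: "s \<in> S" by blast
  then have "s \<noteq> 0" using S(2) dependent_zero by blast
  then obtain b where b: "b \<in> L" "b \<noteq> 0" "\<And>x. x \<in> L \<Longrightarrow> x \<noteq> 0 \<Longrightarrow> norm b \<le> norm x"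
    using discrete_subgroup_shortest[OF L] s S(1) by blast
  have "norm b \<le> succ_min L (cball 0 1) j"
    unfolding succ_min_def
  proof (rule cInf_greatest)
    have "norm s \<le> 1 + (\<Sum>s\<in>S. norm s)" if "s \<in> S" for s
      using member_le_sum[OF that, of norm] fin by simp
    moreover have "1 + (\<Sum>s\<in>S. norm s) > 0" by (simp add: add_pos_nonneg sum_nonneg)
    ultimately show "{lam. lam > 0 \<and> int j \<le> aff_dim (L \<inter> (\<lambda>x. lam *\<^sub>R x) ` cball 0 1)} \<noteq> {}"
      using succ_min_set_member[OF S _ _ L0] by blast
  next
    fix lam assume "lam \<in> {lam. lam > 0 \<and> int j \<le> aff_dim (L \<inter> (\<lambda>x. lam *\<^sub>R x) ` cball 0 1)}"
    then have lam0: "lam > 0" and "int j \<le> aff_dim (L \<inter> (\<lambda>x. lam *\<^sub>R x) ` cball 0 1)" by simp_all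
    then have lam: "int j \<le> aff_dim (L \<inter> cball 0 lam)" by (simp only: scaled_unit_cball)
    show "norm b \<le> lam"
    proof (rule ccontr)
      assume "\<not> norm b \<le> lam"
      then have "L \<inter> cball 0 lam \<subseteq> {0}" using b(3) by force
      then have "aff_dim (L \<inter> cball 0 lam) \<le> aff_dim {0::'a}" by (rule aff_dim_subset)
      then show False using lam j by simp
    qed
  qed
  moreover have "norm b > 0" using b(2) by simp
  ultimately show ?thesis by linarith
qed

text \<open>Applied to the lengths of a reduced basis, so that its first \<open>j\<close> vectors
  witness a bound on the \<open>j\<close>th minimum.\<close>

lemma sorted_enumeration:
  fixes f :: "'b \<Rightarrow> real"
  assumes "finite B"
  shows "\<exists>h. bij_betw h {1..card B} B \<and> (\<forall>i\<in>{1..card B}. \<forall>j\<in>{1..card B}. i \<le> j \<longrightarrow> f (h i) \<le> f (h j))"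
  using assms
proof (induction "card B" arbitrary: B)
  case 0
  then show ?case by (simp add: bij_betw_def)
next
  case (Suc m)
  then have "B \<noteq> {}" by auto
  then have "Max (f ` B) \<in> f ` B" using \<open>finite B\<close> by (intro Max_in) simp_all
  then obtain y where y: "y \<in> B" "f y = Max (f ` B)" by auto
  then have ymax: "f z \<le> f y" if "z \<in> B" for z using \<open>finite B\<close> that by simp
  have c: "m = card (B - {y})" using Suc.hyps(2) y(1) Suc.prems by simp
  obtain h where h: "bij_betw h {1..m} (B - {y})"
    "\<And>i j. i \<in> {1..m} \<Longrightarrow> j \<in> {1..m} \<Longrightarrow> i \<le> j \<Longrightarrow> f (h i) \<le> f (h j)"
  proof -
    have "finite (B - {y})" using Suc.prems by simp
    from Suc.hyps(1)[OF c this] show ?thesis using that unfolding c[symmetric] by blast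
  qed
  define h' where "h' = h(Suc m := y)"
  have eq: "{1..Suc m} = insert (Suc m) {1..m}" by auto
  have "h' ` {1..m} = h ` {1..m}" by (intro image_cong) (simp_all add: h'_def)
  also have "\<dots> = B - {y}" using h(1) unfolding bij_betw_def by blast
  finally have "h' ` {1..Suc m} = insert (h' (Suc m)) (B - {y})" unfolding eq by simp
  also have "\<dots> = B" using y(1) by (simp add: h'_def insert_absorb)
  finally have img: "h' ` {1..Suc m} = B" .
  have "inj_on h' {1..Suc m}"
    by (rule eq_card_imp_inj_on) (simp_all only: finite_atLeastAtMost img card_atLeastAtMost Suc.hyps(2)[symmetric] diff_Suc_1)
  then have bij: "bij_betw h' {1..Suc m} B" using img unfolding bij_betw_def by blast
  moreover have "f (h' i) \<le> f (h' j)" if ij: "i \<in> {1..Suc m}" "j \<in> {1..Suc m}" "i \<le> j" for i j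
  proof (cases "j = Suc m")
    case True
    have "h' i \<in> B" using bij_betwE[OF bij] ij(1) by blast
    then show ?thesis using ymax True by (simp add: h'_def)
  next
    case False
    then show ?thesis using h(2)[of i j] ij by (simp add: h'_def)
  qed
  ultimately show ?case using bij unfolding Suc.hyps(2)[symmetric] by blast
qed

theorem theorem11:
  fixes k :: nat
  assumes "1 \<le> k" and "k \<le> DIM('a::euclidean_space) - 1"
  shows "\<exists>C::real. \<forall>L::'a set.
           is_lattice L \<and> succ_min L (cball 0 1) DIM('a) \<le> 1 \<longrightarrow>
           (\<exists>S. finite S \<and> (\<forall>V\<in>S. subspace V \<and> dim V = k) \<and>
                L \<inter> cball 0 1 \<subseteq> \<Union>S \<and>
                real (card S) \<le> C * alpha L k ^ (DIM('a) - k))"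
proof -
  define d where "d = DIM('a)"
  have kd: "1 \<le> k" "k < d" using assms unfolding d_def by linarith+
  \<comment> \<open>\<open>k < d\<close> gives \<open>i \<ge> 2\<close> throughout, so the
    denominators \<open>i - 1\<close> are positive.\<close>
  define Is where "Is = {d - k + 1..d}"
  have Is: "finite Is" "Is \<noteq> {}" using kd by (auto simp: Is_def)
  obtain Cr where Cr: "Cr \<ge> 1"
    and R: "\<And>L::'a set. discrete_subgroup L \<Longrightarrow> dim L = d \<Longrightarrow>
     (\<exists>B\<subseteq>L. finite B \<and> card B = d \<and> independent B \<and>
        (\<forall>x\<in>L. \<exists>c::'a \<Rightarrow> int. x = (\<Sum>b\<in>B. of_int (c b) *\<^sub>R b) \<and>
           (\<forall>b\<in>B. \<bar>of_int (c b)\<bar> * norm b \<le> Cr * norm x)))"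
    using reduced_basis[of d, where 'a = 'a] by blast
  \<comment> \<open>Discarding \<open>d - i\<close> coordinates leaves dimension
    \<open>k - (d - i)\<close> for the covering subspaces, which is at least 1 because
    \<open>i \<ge> d - k + 1\<close>.\<close>
  have "\<exists>C\<ge>1. box_cover_bound TYPE('a) i (k - (d - i)) C" if "i \<in> Is" for i
  proof -
    have "d - k + 1 \<le> i" "i \<le> d" using that by (simp_all add: Is_def)
    then have "1 \<le> k - (d - i)" "k - (d - i) \<le> i" "i \<le> DIM('a)" using kd unfolding d_def by linarith+
    then show ?thesis by (rule box_cover_bound_exists)
  qed
  then obtain Cf where Cf: "\<And>i. i \<in> Is \<Longrightarrow> Cf i \<ge> 1"
    "\<And>i. i \<in> Is \<Longrightarrow> box_cover_bound TYPE('a) i (k - (d - i)) (Cf i)" by metis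
  define e where "e i = real (d - k) / real (i - 1)" for i
  \<comment> \<open>The minimising \<open>i\<close> depends on \<open>L\<close>, so the constant
    sums over all candidates.\<close>
  define K where "K = (\<Sum>i\<in>Is. Cf i * (Cr ^ i) powr e i)"
  have "\<exists>S. finite S \<and> (\<forall>V\<in>S. subspace V \<and> dim V = k) \<and> L \<inter> cball 0 1 \<subseteq> \<Union>S \<and>
      real (card S) \<le> K * alpha L k ^ (d - k)"
    if L: "is_lattice L" and l1: "succ_min L (cball 0 1) d \<le> 1" for L :: "'a set"
  proof (rule coverable_exact_dim)
    show "k \<le> DIM('a)" using kd unfolding d_def by simp
    have disc: "discrete_subgroup L" and dimL: "dim L = d"
      using is_lattice_discrete_subgroup[OF L] unfolding d_def by blast+
    have L0: "0 \<in> L" using disc unfolding discrete_subgroup_def by blast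
    obtain B where B: "B \<subseteq> L" "finite B" "card B = d" "independent B"
      and Bc: "\<And>x. x \<in> L \<Longrightarrow> \<exists>c::'a \<Rightarrow> int. x = (\<Sum>b\<in>B. of_int (c b) *\<^sub>R b) \<and>
           (\<forall>b\<in>B. \<bar>of_int (c b)\<bar> * norm b \<le> Cr * norm x)"
      using R[OF disc dimL] by blast
    obtain h where h: "bij_betw h {1..d} B"
      and mono: "\<And>i j. i \<in> {1..d} \<Longrightarrow> j \<in> {1..d} \<Longrightarrow> i \<le> j \<Longrightarrow> norm (h i) \<le> norm (h j)"
      using sorted_enumeration[OF B(2), of norm] unfolding B(3) by blast
    define l where "l j = succ_min L (cball 0 1) j" for j
    have hB: "h j \<in> B" if "j \<in> {1..d}" for j using bij_betwE[OF h] that by blast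
    have h0: "norm (h j) > 0" if "j \<in> {1..d}" for j
      using hB[OF that] B(4) dependent_zero[of B] by (cases "h j = 0") auto
    have lpos: "l j > 0" if "j \<in> {1..d}" for j
      unfolding l_def using that B(3) by (intro succ_min_pos[OF disc B(1,4)]) simp_all
    have lle1: "l j \<le> 1" if "j \<in> {1..d}" for j
    proof -
      have "l j \<le> l d" unfolding l_def using that B(3) by (intro succ_min_mono[OF B(1,4) _ L0]) simp_all
      then show ?thesis using l1 unfolding l_def by linarith
    qed
    \<comment> \<open>The first \<open>j\<close> basis vectors are independent and no longer than
      \<open>h j\<close>.\<close>
    have lh: "l j \<le> norm (h j)" if j: "j \<in> {1..d}" for j
      unfolding l_def
    proof (rule succ_min_le[where S = "h ` {1..j}"])
      have sub: "{1..j} \<subseteq> {1..d}" using j by simp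
      have hsub: "h ` {1..j} \<subseteq> B" using hB sub by blast
      then show "h ` {1..j} \<subseteq> L" using B(1) by blast
      show "independent (h ` {1..j})" using B(4) hsub by (rule independent_mono)
      have "inj_on h {1..j}" using h sub unfolding bij_betw_def by (meson inj_on_subset)
      then show "j \<le> card (h ` {1..j})" by (simp add: card_image)
      show "norm s \<le> norm (h j)" if s: "s \<in> h ` {1..j}" for s
      proof -
        obtain i where i: "i \<in> {1..j}" "s = h i" using s by blast
        then show ?thesis using mono[of i j] sub j by auto
      qed
    qed (use h0[OF j] L0 in simp_all)
    \<comment> \<open>The reduced basis bounds the \<open>j\<close>th coefficient by
      \<open>Cr / norm (h j)\<close> on the unit ball, hence by \<open>Cr / l j\<close>. The
      assumption on the last minimum makes these sides at least 1.\<close>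
    define N where "N j = Cr / l j" for j
    have N1: "1 \<le> N j" if "j \<in> {1..d}" for j
      using lpos[OF that] lle1[OF that] Cr unfolding N_def by (simp add: pos_le_divide_eq)
    have Lbox: "L \<inter> cball 0 1 \<subseteq> lattice_box {1..d} h N"
    proof
      fix x assume x: "x \<in> L \<inter> cball 0 1"
      then obtain c :: "'a \<Rightarrow> int" where c: "x = (\<Sum>b\<in>B. of_int (c b) *\<^sub>R b)"
        "\<And>b. b \<in> B \<Longrightarrow> \<bar>of_int (c b)\<bar> * norm b \<le> Cr * norm x" using Bc by blast
      have "x = (\<Sum>j\<in>{1..d}. of_int ((c \<circ> h) j) *\<^sub>R h j)"
        unfolding c(1) using sum.reindex_bij_betw[OF h, of "\<lambda>b. of_int (c b) *\<^sub>R b"] by simp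
      moreover have "\<bar>of_int ((c \<circ> h) j)\<bar> \<le> N j" if j: "j \<in> {1..d}" for j
      proof -
        have "\<bar>real_of_int (c (h j))\<bar> * l j \<le> \<bar>real_of_int (c (h j))\<bar> * norm (h j)"
          using lh[OF j] by (intro mult_left_mono) simp_all
        also have "\<dots> \<le> Cr * norm x" using c(2)[OF hB[OF j]] .
        also have "\<dots> \<le> Cr * 1" using x Cr by (intro mult_left_mono) simp_all
        finally show ?thesis using lpos[OF j] unfolding N_def by (simp add: pos_le_divide_eq)
      qed
      ultimately show "x \<in> lattice_box {1..d} h N" unfolding lattice_box_def by blast
    qed
    define a where "a i = (\<Prod>j\<in>{d - i + 1..d}. l j) powr (- 1 / (real i - 1))" for i
    have alpha: "alpha L k = Min (a ` Is)"
      unfolding alpha_def a_def Is_def l_def d_def ..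
    have "Min (a ` Is) \<in> a ` Is" using Is by (intro Min_in) simp_all
    then obtain i where i: "i \<in> Is" "alpha L k = a i" unfolding alpha by auto
    have id: "d - k + 1 \<le> i" "i \<le> d" using i(1) by (simp_all add: Is_def)
    \<comment> \<open>\<open>J\<close> keeps the \<open>i\<close> largest minima, that is, the
      shortest sides; the longest sides are the ones worth giving up.\<close>
    define J where "J = {d - i + 1..d}"
    have J: "J \<subseteq> {1..d}" "card J = i" "finite J" using id by (simp_all add: J_def)
    \<comment> \<open>Box and subspaces lose the same number \<open>d - i\<close> of dimensions, so
      the codimension stays \<open>d - k\<close>.\<close>
    have exponent: "i - (k - (d - i)) = d - k" using id kd by linarith
    have "coverable (lattice_box J h N) (k - (d - i)) (Cf i * (\<Prod>j\<in>J. N j) powr (real (i - (k - (d - i))) / real (i - 1)))"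
      using J id N1 by (intro box_cover_boundD[OF Cf(2)[OF i(1)]]) (auto simp: d_def)
    then have cov: "coverable (lattice_box {1..d} h N) (k - (d - i) + card ({1..d} - J))
        (Cf i * (\<Prod>j\<in>J. N j) powr e i)"
      unfolding exponent e_def using J(1) by (intro coverable_lattice_box_subset) simp_all
    have "card ({1..d} - J) = d - i" using J by (simp add: card_Diff_subset)
    then have kk: "k - (d - i) + card ({1..d} - J) = k" using id kd by linarith
    have aJ: "a i = (\<Prod>j\<in>J. l j) powr (- 1 / (real i - 1))" by (simp add: a_def J_def)
    have Ppos: "(\<Prod>j\<in>J. l j) > 0" using lpos J(1) by (intro prod_pos) blast
    \<comment> \<open>Up to sign, \<open>e i = (d - k) / (i - 1)\<close> is the exponent in
      \<open>alpha\<close> multiplied by \<open>d - k\<close>.\<close>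
    have "(\<Prod>j\<in>J. N j) powr e i = (Cr ^ i) powr e i * a i ^ (d - k)"
    proof -
      have "(\<Prod>j\<in>J. N j) = Cr ^ i / (\<Prod>j\<in>J. l j)" using J(2) by (simp add: N_def prod_dividef)
      then have "(\<Prod>j\<in>J. N j) powr e i = (Cr ^ i) powr e i / (\<Prod>j\<in>J. l j) powr e i"
        by (simp add: powr_divide)
      also have "\<dots> = (Cr ^ i) powr e i * (\<Prod>j\<in>J. l j) powr (- e i)"
        by (simp add: powr_minus divide_inverse)
      also have "- e i = (- 1 / (real i - 1)) * real (d - k)"
        using id kd by (simp add: e_def of_nat_diff)
      also have "(\<Prod>j\<in>J. l j) powr ((- 1 / (real i - 1)) * real (d - k)) = a i ^ (d - k)"
        unfolding aJ powr_powr[symmetric] using Ppos by (intro powr_realpow) simp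
      finally show ?thesis .
    qed
    then have "coverable (lattice_box {1..d} h N) k (Cf i * (Cr ^ i) powr e i * alpha L k ^ (d - k))"
      using cov unfolding kk i(2) by (simp add: mult.assoc)
    moreover have "Cf i * (Cr ^ i) powr e i * alpha L k ^ (d - k) \<le> K * alpha L k ^ (d - k)"
    proof (rule mult_right_mono)
      have "0 \<le> Cf i * (Cr ^ i) powr e i" if "i \<in> Is" for i using Cf(1)[OF that] by simp
      then show "Cf i * (Cr ^ i) powr e i \<le> K"
        unfolding K_def using i(1) Is(1) by (intro member_le_sum) auto
      show "0 \<le> alpha L k ^ (d - k)" unfolding i(2) aJ by simp
    qed
    ultimately show "coverable (L \<inter> cball 0 1) k (K * alpha L k ^ (d - k))"
      using Lbox by (meson coverable_mono order_refl)
  qed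
  then show ?thesis unfolding d_def by blast
qed

end
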